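(* Let $n\ge k\ge 2$ be integers, and let $t\ge 0$ be an integer. For the devoid complex $\mathcal{D}(C_n;P_k)$ the following homotopy equivalence holds: $$\mathcal{D}(C_n;P_k)\simeq\begin{cases}\bigvee^{k} S^{t(k-1)-1}, & \text{if } n=(k+1)t,\\ S^{t(k-1)-1}, & \text{if } n=(k+1)t+1,\\ S^{t(k-1)+d-2}, & \text{if } n=(k+1)t+d \text{ with } 2\le d\le k-1,\\ S^{t(k-1)+k-2}, & \text{if } n=(k+1)t+k,\end{cases}$$ where $\bigvee^{k}$ denotes a wedge of $k$ copies.
   Context: Graphs are finite and undirected; multiple edges are allowed. $P_k$ denotes the path graph on $k$ vertices, and $C_n$ the cycle graph on $n$ vertices ($C_2$ is a double edge on two vertices). For a graph $G=(V,E)$ and $S\subseteq V$, $G[S]$ is the subgraph induced by $S$. A graph is $F$-free if it contains no (not necessarily induced) subgraph isomorphic to $F$. The devoid complex $\mathcal{D}(G;F)$ is the simplicial complex on $V$ whose faces are those subsets $S\subseteq V$ such that $G[S]$ is $F$-free. $S^m$ denotes the $m$-dimensional sphere. *)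

theory Defs
  imports "HOL-Analysis.Analysis"
begin

section \<open>Multigraphs\<close>

text \<open>Parallel edges are distinct elements of \<open>edges\<close> with the same set of ends. Only the values of
  \<open>ends\<close> on \<open>edges\<close> are meaningful.\<close>

record ('v, 'e) multigraph =
  verts :: "'v set"
  edges :: "'e set"
  ends :: "'e \<Rightarrow> 'v set"

definition finite_multigraph :: "('v, 'e) multigraph \<Rightarrow> bool" where
  "finite_multigraph G \<longleftrightarrow> finite (verts G) \<and> finite (edges G) \<and>
     (\<forall>e\<in>edges G. ends G e \<subseteq> verts G \<and> card (ends G e) = 2)"

definition subgraph :: "('v, 'e) multigraph \<Rightarrow> ('v, 'e) multigraph \<Rightarrow> bool" where
  "subgraph H G \<longleftrightarrow> verts H \<subseteq> verts G \<and> edges H \<subseteq> edges G \<and>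
     (\<forall>e\<in>edges H. ends H e = ends G e \<and> ends H e \<subseteq> verts H)"

definition induced_subgraph :: "('v, 'e) multigraph \<Rightarrow> 'v set \<Rightarrow> ('v, 'e) multigraph" where
  "induced_subgraph G S =
     \<lparr>verts = verts G \<inter> S, edges = {e \<in> edges G. ends G e \<subseteq> S}, ends = ends G\<rparr>"

definition graph_isomorphic :: "('v, 'e) multigraph \<Rightarrow> ('w, 'f) multigraph \<Rightarrow> bool" where
  "graph_isomorphic G H \<longleftrightarrow>
     (\<exists>f g. bij_betw f (verts G) (verts H) \<and> bij_betw g (edges G) (edges H) \<and>
        (\<forall>e\<in>edges G. ends H (g e) = f ` ends G e))"

definition graph_free :: "('w, 'f) multigraph \<Rightarrow> ('v, 'e) multigraph \<Rightarrow> bool" where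
  "graph_free F G \<longleftrightarrow> \<not> (\<exists>H. subgraph H G \<and> graph_isomorphic F H)"

definition path_graph :: "nat \<Rightarrow> (nat, nat) multigraph" where
  "path_graph k = \<lparr>verts = {..<k}, edges = {i. Suc i < k}, ends = (\<lambda>i. {i, Suc i})\<rparr>"

text \<open>For \<open>n = 2\<close> the two edges \<open>0\<close> and \<open>1\<close> both have ends \<open>{0, 1}\<close>, i.e. this is a double edge.
  The definition is only meant for \<open>n \<ge> 2\<close>.\<close>

definition cycle_graph :: "nat \<Rightarrow> (nat, nat) multigraph" where
  "cycle_graph n = \<lparr>verts = {..<n}, edges = {..<n}, ends = (\<lambda>i. {i, Suc i mod n})\<rparr>"

lemma finite_multigraph_path: "finite_multigraph (path_graph k)"
proof -
  have "finite {i. Suc i < k}"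
    by (rule finite_subset[of _ "{..<k}"]) auto
  then show ?thesis
    by (auto simp: finite_multigraph_def path_graph_def)
qed

lemma finite_multigraph_cycle:
  assumes "2 \<le> n"
  shows "finite_multigraph (cycle_graph n)"
proof -
  have "i \<noteq> Suc i mod n" if "i < n" for i
    using that assms by (cases "Suc i = n") auto
  then show ?thesis
    using assms by (auto simp: finite_multigraph_def cycle_graph_def)
qed

section \<open>The devoid complex and geometric realizations\<close>

definition devoid_complex :: "('v, 'e) multigraph \<Rightarrow> ('w, 'f) multigraph \<Rightarrow> 'v set set" where
  "devoid_complex G F = {S. S \<subseteq> verts G \<and> graph_free F (induced_subgraph G S)}"

lemma devoid_complex_downward_closed:
  assumes "S \<in> devoid_complex G F" "T \<subseteq> S"
  shows "T \<in> devoid_complex G F"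
proof -
  have "subgraph H (induced_subgraph G S)" if "subgraph H (induced_subgraph G T)" for H
    using that assms(2) by (fastforce simp: subgraph_def induced_subgraph_def)
  then show ?thesis
    using assms by (auto simp: devoid_complex_def graph_free_def)
qed

text \<open>A point of the realization is given by its barycentric coordinates: a convex combination of
  the vertices whose support is a face. (An infinite or empty support is excluded by the sum.)
  The topology is the one inherited from the product of copies of the real line; for a complex with
  finitely many vertices this is the usual topology of the geometric realization.\<close>

definition geometric_realization :: "'v set set \<Rightarrow> ('v \<Rightarrow> real) topology" where
  "geometric_realization K = subtopology (powertop_real UNIV)
     {x. (\<forall>v. 0 \<le> x v) \<and> {v. x v \<noteq> 0} \<in> K \<and> (\<Sum>v | x v \<noteq> 0. x v) = 1}"

section \<open>Wedge sums\<close>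

definition quotient_topology :: "'a topology \<Rightarrow> ('a \<Rightarrow> 'b) \<Rightarrow> 'b topology" where
  "quotient_topology X q =
     topology (\<lambda>U. U \<subseteq> q ` topspace X \<and> openin X {x \<in> topspace X. q x \<in> U})"

lemma openin_quotient_topology:
  "openin (quotient_topology X q) U \<longleftrightarrow>
     U \<subseteq> q ` topspace X \<and> openin X {x \<in> topspace X. q x \<in> U}"
proof -
  have "istopology (\<lambda>U. U \<subseteq> q ` topspace X \<and> openin X {x \<in> topspace X. q x \<in> U})"
    unfolding istopology_def
  proof (intro conjI allI impI)
    fix S T
    assume "S \<subseteq> q ` topspace X \<and> openin X {x \<in> topspace X. q x \<in> S}"
      and "T \<subseteq> q ` topspace X \<and> openin X {x \<in> topspace X. q x \<in> T}"
    moreover have "{x \<in> topspace X. q x \<in> S \<inter> T} =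
        {x \<in> topspace X. q x \<in> S} \<inter> {x \<in> topspace X. q x \<in> T}"
      by blast
    ultimately show "S \<inter> T \<subseteq> q ` topspace X" "openin X {x \<in> topspace X. q x \<in> S \<inter> T}"
      by auto
  next
    fix \<K>
    assume *: "\<forall>K\<in>\<K>. K \<subseteq> q ` topspace X \<and> openin X {x \<in> topspace X. q x \<in> K}"
    then show "\<Union>\<K> \<subseteq> q ` topspace X"
      by blast
    have "{x \<in> topspace X. q x \<in> \<Union>\<K>} = (\<Union>K\<in>\<K>. {x \<in> topspace X. q x \<in> K})"
      by blast
    with * show "openin X {x \<in> topspace X. q x \<in> \<Union>\<K>}"
      by auto
  qed
  then show ?thesis
    by (simp add: quotient_topology_def)
qed

lemma topspace_quotient_topology: "topspace (quotient_topology X q) = q ` topspace X"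
proof -
  have "{x \<in> topspace X. q x \<in> q ` topspace X} = topspace X"
    by blast
  then have "openin (quotient_topology X q) (q ` topspace X)"
    by (simp add: openin_quotient_topology)
  then show ?thesis
    by (meson openin_quotient_topology openin_subset openin_topspace subset_antisym)
qed

lemma quotient_map_quotient_topology: "quotient_map X (quotient_topology X q) q"
  by (auto simp: quotient_map_def topspace_quotient_topology openin_quotient_topology)

text \<open>The disjoint union of the spaces \<open>X i\<close>, \<open>i \<in> I\<close>, with all base points \<open>p i\<close> identified
  to the single point \<open>None\<close>.\<close>

definition wedge_sum :: "'i set \<Rightarrow> ('i \<Rightarrow> 'a topology) \<Rightarrow> ('i \<Rightarrow> 'a) \<Rightarrow> ('i \<times> 'a) option topology"
  where
  "wedge_sum I X p = quotient_topology (sum_topology X I)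
     (\<lambda>(i, x). if x = p i then None else Some (i, x))"

text \<open>The base point of every sphere is the first unit vector; see \<open>in_topspace_nsphere\<close>.\<close>

definition wedge_of_spheres :: "nat \<Rightarrow> nat \<Rightarrow> (nat \<times> (nat \<Rightarrow> real)) option topology" where
  "wedge_of_spheres k m = wedge_sum {..<k} (\<lambda>_. nsphere m) (\<lambda>_ i. if i = 0 then 1 else 0)"

end

theory Submission
  imports Defs
begin

text \<open>
  The faces of the devoid complex of \<open>C_n\<close> and \<open>P_k\<close> are the subsets of the cyclically ordered set
  \<open>{0, \<dots>, n - 1}\<close> without \<open>k\<close> cyclically consecutive elements (\<open>devoid_complex_cycle_path\<close>). The homotopy type is
  found by discrete Morse theory: an acyclic matching on these faces is exhibited whose critical faces all have the
  same dimension \<open>m\<close>. By \<open>equidimensional_matching_wedge\<close> the complex is then a wedge of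
  \<open>m\<close>-spheres, one for each critical face.

  The matching tries certain vertices in turn and toggles the first one that \<open>S\<close> contains or could contain. Vertex \<open>0\<close> is tried
  first. It can be added to \<open>S\<close> unless \<open>S\<close> begins with a run \<open>1, \<dots>, b\<close> and contains the last
  \<open>k - 1 - b\<close> vertices of the cycle. In that case \<open>b + 1\<close> is missing from \<open>S\<close> and \<open>b + 2\<close> is tried; it can be added
  unless the next \<open>k - 1\<close> vertices are all present. Then \<open>b + 2\<close> and \<open>b + k + 2\<close> are missing,
  and the vertex \<open>b + k + 3\<close> is in the same position as \<open>b + 2\<close> was. The scan thus proceeds in blocks of length
  \<open>k + 1\<close>, each containing \<open>k - 1\<close> vertices of \<open>S\<close>. A set is critical if the
  scan reaches the forced final vertices, or the end of the cycle, before it finds a vertex to toggle (\<open>critical_eq_crit\<close>). This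
  happens for every \<open>b < k\<close> if \<open>k + 1\<close> divides \<open>n\<close>, and otherwise only for \<open>b + 1 = n mod (k + 1)\<close>.
  Writing \<open>n = (k + 1) * t + d\<close>, the critical sets have \<open>t * (k - 1)\<close> elements for \<open>d = 0\<close> and
  \<open>t * (k - 1) + d - 1\<close> elements otherwise, whence the dimensions in the theorem.

  The topological part rests on explicit formulas in barycentric coordinates. Subtracting the least coordinate of
  a face is a continuous way to leave its interior; it provides the elementary collapses
  (\<open>elementary_collapse\<close>), the homotopy extension property for attached
  simplices (\<open>lower_contraction_extends\<close>), and the map from a simplex onto a sphere that is injective off the boundary
  (\<open>simplex_to_sphere\<close>). With these, the matched pairs reaching above the critical dimension are collapsed
  away, the noncritical faces that remain form a contractible complex, and collapsing that complex to a point leaves the wedge of spheres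
  (\<open>homotopy_equivalent_wedge\<close>).
\<close>

section \<open>Polyhedra of finite complexes\<close>

definition finite_complex :: "'v set set \<Rightarrow> bool" where
  "finite_complex K \<longleftrightarrow> finite (\<Union>K) \<and> (\<forall>S\<in>K. \<forall>T\<subseteq>S. T \<in> K)"

definition realization_points :: "'v set set \<Rightarrow> ('v \<Rightarrow> real) set" where
  "realization_points K =
     {x. (\<forall>v. 0 \<le> x v) \<and> {v. x v \<noteq> 0} \<in> K \<and> (\<Sum>v | x v \<noteq> 0. x v) = 1}"

text \<open>The type class topology on \<open>'v \<Rightarrow> real\<close> is the product topology, so realizations become subspaces
  in the sense of \<open>top_of_set\<close> and continuity can be argued with \<open>continuous_on\<close>.\<close>

lemma geometric_realization_eq: "geometric_realization K = top_of_set (realization_points K)"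
  by (simp add: geometric_realization_def realization_points_def euclidean_product_topology)

lemma finite_complex_finite: "finite_complex K \<Longrightarrow> finite K"
  by (simp add: finite_complex_def finite_UnionD)

lemma finite_complex_face: "finite_complex K \<Longrightarrow> S \<in> K \<Longrightarrow> T \<subseteq> S \<Longrightarrow> T \<in> K"
  by (auto simp: finite_complex_def)

lemma finite_complex_finite_face: "finite_complex K \<Longrightarrow> S \<in> K \<Longrightarrow> finite S"
  by (meson Union_upper finite_complex_def finite_subset)

lemma finite_complex_subset:
  assumes "finite_complex K" "K' \<subseteq> K" "\<And>S T. S \<in> K' \<Longrightarrow> T \<subseteq> S \<Longrightarrow> T \<in> K'"
  shows "finite_complex K'"
  using assms unfolding finite_complex_def by (meson Union_mono finite_subset)

lemma realization_points_mono: "K' \<subseteq> K \<Longrightarrow> realization_points K' \<subseteq> realization_points K"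
  by (auto simp: realization_points_def)

lemma realization_pointsI:
  assumes "finite T" "\<And>v. 0 \<le> x v" "{v. x v \<noteq> 0} \<in> K" "\<And>v. v \<notin> T \<Longrightarrow> x v = 0" "sum x T = 1"
  shows "x \<in> realization_points K"
proof -
  have "(\<Sum>v | x v \<noteq> 0. x v) = sum x T"
    using assms(1,4) by (intro sum.mono_neutral_left) auto
  then show ?thesis
    using assms by (auto simp: realization_points_def)
qed

lemma realization_pointsD:
  assumes "x \<in> realization_points K"
  shows realization_points_nonneg: "0 \<le> x v" 
    and realization_points_support: "{v. x v \<noteq> 0} \<in> K"
    and realization_points_finite_support: "finite {v. x v \<noteq> 0}"
    and realization_points_sum: "\<And>T. finite T \<Longrightarrow> {v. x v \<noteq> 0} \<subseteq> T \<Longrightarrow> sum x T = 1"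
proof -
  show "0 \<le> x v" "{v. x v \<noteq> 0} \<in> K" 
    using assms by (auto simp: realization_points_def)
  show "finite {v. x v \<noteq> 0}"
    using assms by (auto simp: realization_points_def intro: ccontr)
  fix T assume "finite T" "{v. x v \<noteq> 0} \<subseteq> T"
  then have "sum x T = (\<Sum>v | x v \<noteq> 0. x v)"
    by (intro sum.mono_neutral_right) auto
  with assms show "sum x T = 1" by (simp add: realization_points_def)
qed

lemma compact_realization_points:
  assumes "finite_complex K"
  shows "compact (realization_points K)"
proof -
  define C where "C = (\<Union>S\<in>K. {x::'a\<Rightarrow>real. (\<forall>v. 0 \<le> x v) \<and> (\<forall>v. v \<in> S \<or> x v = 0) \<and> sum x S = 1})"
  have eq: "realization_points K = C"
  proof (intro set_eqI iffI)
    fix x assume x: "x \<in> realization_points K"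
    then show "x \<in> C"
      unfolding C_def using realization_pointsD[OF x]
      by (intro UN_I[of "{v. x v \<noteq> 0}"]) auto
  next
    fix x assume "x \<in> C"
    then obtain S where "S \<in> K" and "(\<forall>v. 0 \<le> x v) \<and> (\<forall>v. v \<in> S \<or> x v = 0) \<and> sum x S = 1"
      unfolding C_def by blast
    then have S: "S \<in> K" "\<And>v. 0 \<le> x v" "\<And>v. v \<notin> S \<Longrightarrow> x v = 0" "sum x S = 1"
      by auto
    moreover have "{v. x v \<noteq> 0} \<in> K"
      by (rule finite_complex_face[OF assms S(1)]) (use S(3) in auto)
    ultimately show "x \<in> realization_points K"
      using finite_complex_finite_face[OF assms S(1)] by (intro realization_pointsI[of S]) auto
  qed
  have "closed {x::'a\<Rightarrow>real. (\<forall>v. 0 \<le> x v) \<and> (\<forall>v. v \<in> S \<or> x v = 0) \<and> sum x S = 1}" for S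
    by (intro closed_Collect_conj closed_Collect_all closed_Collect_disj closed_Collect_const closed_Collect_le
        closed_Collect_eq continuous_intros continuous_on_product_coordinates)
  then have "closed (realization_points K)"
    unfolding eq C_def using finite_complex_finite[OF assms] by blast
  moreover have "compact (Pi\<^sub>E UNIV (\<lambda>_::'a. {0..1::real}))"
    using compactin_PiE[of "\<lambda>_::'a. euclideanreal" UNIV "\<lambda>_. {0..1}"]
    by (simp add: euclidean_product_topology)
  moreover have "realization_points K \<subseteq> Pi\<^sub>E UNIV (\<lambda>_. {0..1})"
  proof
    fix x assume x: "x \<in> realization_points K"
    have "x v \<le> 1" for v
    proof -
      let ?T = "insert v {v. x v \<noteq> 0}"
      have "finite ?T" using realization_points_finite_support[OF x] by simp
      then have "x v \<le> sum x ?T"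
        using realization_points_nonneg[OF x] by (intro member_le_sum) auto
      also have "\<dots> = 1"
        using realization_points_sum[OF x \<open>finite ?T\<close>] by auto
      finally show ?thesis .
    qed
    then show "x \<in> Pi\<^sub>E UNIV (\<lambda>_. {0..1})"
      using realization_points_nonneg[OF x] by auto
  qed
  ultimately show ?thesis
    using compact_Int_closed[of "Pi\<^sub>E UNIV (\<lambda>_::'a. {0..1::real})" "realization_points K"]
    by (simp add: Int_absorb1)
qed

section \<open>Collapses\<close>

definition min_coord :: "'v set \<Rightarrow> ('v \<Rightarrow> real) \<Rightarrow> real" where
  "min_coord \<tau> x = Min (x ` \<tau>)"

lemma continuous_on_min_coord [continuous_intros]:
  fixes f :: "'b::topological_space \<Rightarrow> 'v \<Rightarrow> real"
  assumes "finite \<tau>" "\<tau> \<noteq> {}" "continuous_on A f"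
  shows "continuous_on A (\<lambda>z. min_coord \<tau> (f z))"
  using assms(1,2)
proof (induction rule: finite_ne_induct)
  case (singleton v)
  then show ?case
    using continuous_on_product_then_coordinatewise[OF assms(3)] by (simp add: min_coord_def)
next
  case (insert v F)
  have "min_coord (insert v F) (f z) = min (f z v) (min_coord F (f z))" for z
    using insert by (simp add: min_coord_def)
  then show ?case
    using insert continuous_on_product_then_coordinatewise[OF assms(3)]
    by (auto intro: continuous_intros)
qed

lemma continuous_on_coord_snd: "continuous_on A (\<lambda>z. snd z u)"
  by (rule continuous_on_product_then_coordinatewise) (intro continuous_on_snd continuous_on_id)

lemma min_coord_le: "finite \<tau> \<Longrightarrow> v \<in> \<tau> \<Longrightarrow> min_coord \<tau> x \<le> x v"
  by (simp add: min_coord_def)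

lemma min_coord_attained:
  assumes "finite \<tau>" "\<tau> \<noteq> {}"
  obtains v where "v \<in> \<tau>" "x v = min_coord \<tau> x"
proof -
  have "Min (x ` \<tau>) \<in> x ` \<tau>"
    using assms by (intro Min_in) auto
  then show ?thesis
    using that by (auto simp: min_coord_def)
qed

lemma min_coord_nonneg:
  assumes "x \<in> realization_points K" "finite \<tau>" "\<tau> \<noteq> {}"
  shows "0 \<le> min_coord \<tau> x"
  by (metis assms min_coord_attained realization_points_nonneg)

lemma min_coord_pos_iff:
  assumes "x \<in> realization_points K" "finite \<tau>" "\<tau> \<noteq> {}"
  shows "0 < min_coord \<tau> x \<longleftrightarrow> \<tau> \<subseteq> {v. x v \<noteq> 0}"
proof
  assume *: "0 < min_coord \<tau> x"
  show "\<tau> \<subseteq> {v. x v \<noteq> 0}"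
  proof
    fix v assume "v \<in> \<tau>"
    then have "0 < x v"
      using * min_coord_le[OF assms(2), of v x] by linarith
    then show "v \<in> {v. x v \<noteq> 0}" by simp
  qed
next
  assume *: "\<tau> \<subseteq> {v. x v \<noteq> 0}"
  obtain v where v: "v \<in> \<tau>" "x v = min_coord \<tau> x"
    using min_coord_attained[OF assms(2,3)] .
  then have "x v \<noteq> 0" using * by blast
  then show "0 < min_coord \<tau> x"
    using realization_points_nonneg[OF assms(1), of v] v(2) by linarith
qed

text \<open>If \<open>insert v \<sigma>\<close> is the only proper coface of \<open>\<sigma>\<close>, the open simplices of both can be pushed away
  from the barycenter of \<open>\<sigma>\<close>: lower all coordinates in \<open>\<sigma>\<close> by the same amount \<open>s * min_coord \<sigma> x\<close> and
  give the lost mass to \<open>v\<close>. At \<open>s = 1\<close> some coordinate in \<open>\<sigma>\<close> vanishes. The minimum is positive only at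
  points whose support contains \<open>\<sigma>\<close>, so one formula serves on the whole realization: its continuity needs
  no pasting, and it moves nothing outside the two simplices.\<close>

lemma elementary_collapse:
  assumes K: "finite_complex K" and \<sigma>: "\<sigma> \<noteq> {}" "v \<notin> \<sigma>" "insert v \<sigma> \<in> K"
    and free: "\<And>S. S \<in> K \<Longrightarrow> \<sigma> \<subseteq> S \<Longrightarrow> S = \<sigma> \<or> S = insert v \<sigma>"
  shows "geometric_realization K homotopy_equivalent_space
         geometric_realization (K - {\<sigma>, insert v \<sigma>})"
proof -
  let ?K' = "K - {\<sigma>, insert v \<sigma>}"
  define r where "r = (\<lambda>(s, x) u. x u + (if u \<in> \<sigma> then - s * min_coord \<sigma> x
      else if u = v then s * real (card \<sigma>) * min_coord \<sigma> x else 0))"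
  have fin: "finite \<sigma>"
    using finite_complex_finite_face[OF K \<sigma>(3)] by simp
  have fixed: "r (s, x) = x" if "min_coord \<sigma> x = 0" for s x
    using that by (auto simp: r_def)
  have zero: "min_coord \<sigma> x = 0" if "x \<in> realization_points ?K'" for x
  proof -
    have "\<not> \<sigma> \<subseteq> {v. x v \<noteq> 0}"
      using realization_points_support[OF that] free by blast
    with min_coord_pos_iff[OF that fin \<sigma>(1)] min_coord_nonneg[OF that fin \<sigma>(1)] show ?thesis
      by linarith
  qed
  have mem: "r (s, x) \<in> realization_points K" if x: "x \<in> realization_points K" and s: "0 \<le> s" "s \<le> 1" for s x
  proof (cases "min_coord \<sigma> x = 0")
    case False
    then have pos: "0 < min_coord \<sigma> x"
      using min_coord_nonneg[OF x fin \<sigma>(1)] by linarith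
    then have "\<sigma> \<subseteq> {v. x v \<noteq> 0}" 
      by (simp add: min_coord_pos_iff[OF x fin \<sigma>(1)])
    then have sup: "{v. x v \<noteq> 0} \<subseteq> insert v \<sigma>"
      using free realization_points_support[OF x] by blast
    show ?thesis
    proof (rule realization_pointsI[of "insert v \<sigma>"])
      show "0 \<le> r (s, x) u" for u
      proof -
        have "s * min_coord \<sigma> x \<le> x u" if "u \<in> \<sigma>"
          using min_coord_le[OF fin that, of x] mult_right_mono[OF s(2), of "min_coord \<sigma> x"] pos
          by linarith
        then show ?thesis
          using realization_points_nonneg[OF x, of u] pos s by (auto simp: r_def)
      qed
      show out: "r (s, x) u = 0" if "u \<notin> insert v \<sigma>" for u
        using that sup by (auto simp: r_def)
      then show "{u. r (s, x) u \<noteq> 0} \<in> K"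
        by (intro finite_complex_face[OF K \<sigma>(3)]) blast
      have "sum (r (s, x)) \<sigma> = sum x \<sigma> - s * real (card \<sigma>) * min_coord \<sigma> x"
        by (simp add: r_def sum_subtractf)
      then have "sum (r (s, x)) (insert v \<sigma>) = sum x (insert v \<sigma>)"
        using fin \<sigma>(2) by (simp add: r_def)
      then show "sum (r (s, x)) (insert v \<sigma>) = 1"
        using realization_points_sum[OF x _ sup] fin by simp
    qed (use fin in simp)
  qed (use x fixed in simp)
  have mem1: "r (1, x) \<in> realization_points ?K'" if x: "x \<in> realization_points K" for x
  proof -
    obtain u where u: "u \<in> \<sigma>" "x u = min_coord \<sigma> x"
      using min_coord_attained[OF fin \<sigma>(1)] .
    then have "r (1, x) u = 0"
      by (simp add: r_def)
    with mem[OF x, of 1] u(1) show ?thesis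
      by (auto simp: realization_points_def)
  qed
  have cont: "continuous_on ({0..1} \<times> realization_points K) r"
  proof (rule continuous_on_coordinatewise_then_product)
    fix u
    have "continuous_on ({0..1} \<times> realization_points K)
        (\<lambda>z. snd z u + (if u \<in> \<sigma> then - fst z * min_coord \<sigma> (snd z)
           else if u = v then fst z * real (card \<sigma>) * min_coord \<sigma> (snd z) else 0))"
      using fin \<sigma>(1)
      by (cases "u \<in> \<sigma>"; cases "u = v")
         (simp_all add: continuous_on_coord_snd continuous_on_min_coord continuous_on_fst
           continuous_on_snd continuous_on_id continuous_on_mult continuous_on_add
           continuous_on_minus continuous_on_diff continuous_on_const)
    then show "continuous_on ({0..1} \<times> realization_points K) (\<lambda>z. r z u)"
      by (simp add: r_def case_prod_unfold)
  qed
  have cont1: "continuous_on (realization_points K) (\<lambda>x. r (1, x))"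
    by (rule continuous_on_compose2[OF cont]) (auto intro: continuous_intros)
  show ?thesis
    unfolding geometric_realization_eq
  proof (rule deformation_retraction_imp_homotopy_equivalent_space)
    show "retraction_maps (top_of_set (realization_points K)) (top_of_set (realization_points ?K')) (\<lambda>x. r (1, x)) id"
      using cont1 mem1 zero fixed realization_points_mono[of ?K' K]
      by (auto simp: retraction_maps_def continuous_map_in_subtopology)
    show "homotopic_with (\<lambda>x. True) (top_of_set (realization_points K)) (top_of_set (realization_points K))
        (id \<circ> (\<lambda>x. r (1, x))) id"
    proof (subst homotopic_with_sym, unfold homotopic_with_def, intro exI[of _ r] conjI)
      show "continuous_map (prod_topology (top_of_set {0..1}) (top_of_set (realization_points K)))
          (top_of_set (realization_points K)) r"
        using cont mem by (auto simp: continuous_map_in_subtopology)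
    qed (auto simp: r_def)
  qed
qed

text \<open>An acyclic matching in the sense of discrete Morse theory. Each face outside \<open>K'\<close> is paired with the one
  obtained by adding or removing the vertex \<open>v S\<close>. Whenever another bottom face \<open>T\<close> lies below the top face
  of \<open>S\<close>, its \<open>rank\<close> is smaller; hence among the bottoms of maximal size one of
  greatest \<open>rank\<close> is a free face, and collapsing it leaves a complex of the same kind.\<close>

lemma acyclic_matching_collapse:
  fixes rank :: "'v set \<Rightarrow> nat"
  assumes "finite_complex K" "finite_complex K'" "K' \<subseteq> K" "{} \<in> K'"
    and toggle: "\<And>S. S \<in> K - K' \<Longrightarrow> insert (v S) S \<in> K - K' \<and> S - {v S} \<in> K - K' \<and>
                   v (insert (v S) S) = v S \<and> v (S - {v S}) = v S"
    and acyclic: "\<And>S x. \<lbrakk>S \<in> K - K'; v S \<notin> S; x \<in> S; insert (v S) S - {x} \<in> K - K'\<rbrakk> \<Longrightarrow>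
                   v (insert (v S) S - {x}) \<in> insert (v S) S - {x} \<or>
                   rank (insert (v S) S - {x}) < rank S"
  shows "geometric_realization K homotopy_equivalent_space geometric_realization K'"
  using assms
proof (induction "card (K - K')" arbitrary: K rule: less_induct)
  case less
  note K = less.prems(1) and K' = less.prems(2) and sub = less.prems(3)
  note toggle = less.prems(5) and acyclic = less.prems(6)
  show ?case
  proof (cases "K = K'")
    case True
    then show ?thesis by (simp add: homotopy_equivalent_space_refl)
  next
    case False
    define B where "B = {S \<in> K - K'. v S \<notin> S}"
    have finB: "finite B"
      using finite_complex_finite[OF K] by (simp add: B_def)
    have "B \<noteq> {}"
    proof -
      obtain S where S: "S \<in> K - K'" using False sub by blast
      then have "S - {v S} \<in> B" using toggle[OF S] by (auto simp: B_def)
      then show ?thesis by blast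
    qed
    define p where "p = Max (card ` B)"
    define B' where "B' = {S \<in> B. card S = p}"
    have pmax: "card S \<le> p" if "S \<in> B" for S
      using that finB by (simp add: p_def)
    have "p \<in> card ` B"
      unfolding p_def using finB \<open>B \<noteq> {}\<close> by (intro Max_in) auto
    then have "B' \<noteq> {}" "finite B'"
      using finB by (auto simp: B'_def)
    then have "Max (rank ` B') \<in> rank ` B'"
      by (intro Max_in) auto
    then obtain \<sigma> where \<sigma>: "\<sigma> \<in> B'" "rank \<sigma> = Max (rank ` B')" by auto
    have rmax: "rank S \<le> rank \<sigma>" if "S \<in> B'" for S
      using that \<open>finite B'\<close> by (simp add: \<sigma>(2))
    have \<sigma>': "\<sigma> \<in> K" "\<sigma> \<notin> K'" "v \<sigma> \<notin> \<sigma>" "card \<sigma> = p"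
      using \<sigma>(1) by (auto simp: B'_def B_def)
    let ?w = "v \<sigma>"
    have t\<sigma>: "insert ?w \<sigma> \<in> K" "insert ?w \<sigma> \<notin> K'" "v (insert ?w \<sigma>) = ?w"
      using toggle[of \<sigma>] \<sigma>' by auto
    have finS: "finite S" if "S \<in> K" for S
      using finite_complex_finite_face[OF K that] .
    have notK': "S \<notin> K'" if "\<sigma> \<subseteq> S" for S
      using that finite_complex_face[OF K'] \<sigma>'(2) by blast
    \<comment> \<open>A coface of \<open>\<sigma>\<close> by one vertex is not a bottom by maximality of \<open>p\<close>,
       so it is the top of a bottom that precedes \<open>\<sigma>\<close>.\<close>
    have step: "x = ?w" if x: "x \<notin> \<sigma>" "insert x \<sigma> \<in> K" for x
    proof -
      let ?S = "insert x \<sigma>"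
      have S: "?S \<in> K - K'" using x notK' by blast
      have "card ?S = Suc p" using x finS[OF \<sigma>'(1)] \<sigma>'(4) by simp
      then have "?S \<notin> B" using pmax by fastforce
      then have top: "v ?S \<in> ?S" using S by (simp add: B_def)
      let ?T = "?S - {v ?S}"
      have T: "?T \<in> K - K'" "v ?T = v ?S" "insert (v ?T) ?T = ?S"
        using toggle[OF S] top by auto
      have "?T \<in> B'"
        using T top \<open>card ?S = Suc p\<close> finS[OF x(2)] by (auto simp: B'_def B_def)
      show ?thesis
      proof (cases "?T = \<sigma>")
        case True
        have "v ?S \<notin> \<sigma>" by (subst True[symmetric]) simp
        with top have "v ?S = x" by blast
        moreover have "v \<sigma> = v ?S" using T(2) unfolding True .
        ultimately show ?thesis by simp
      next
        case False
        then have "x \<in> ?T" using top x by auto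
        moreover have "insert (v ?T) ?T - {x} = \<sigma>" using T(3) x by auto
        ultimately have "v \<sigma> \<in> \<sigma> \<or> rank \<sigma> < rank ?T"
          using acyclic[of ?T x] T \<sigma>' top by auto
        then show ?thesis using \<sigma>'(3) rmax[OF \<open>?T \<in> B'\<close>] by auto
      qed
    qed
    have free: "S = \<sigma> \<or> S = insert ?w \<sigma>" if S: "S \<in> K" "\<sigma> \<subseteq> S" for S
    proof -
      have "x = ?w" if "x \<in> S - \<sigma>" for x
        using that S by (intro step) (auto intro: finite_complex_face[OF K])
      then show ?thesis using S(2) by blast
    qed
    let ?K1 = "K - {\<sigma>, insert ?w \<sigma>}"
    have ne: "\<sigma> \<noteq> {}" using \<sigma>'(2) less.prems(4) by blast
    have "geometric_realization K homotopy_equivalent_space geometric_realization ?K1"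
      by (rule elementary_collapse[OF K ne \<sigma>'(3) t\<sigma>(1)]) (rule free)
    also have "geometric_realization ?K1 homotopy_equivalent_space geometric_realization K'"
    proof (rule less.hyps)
      show "card (?K1 - K') < card (K - K')"
        using finite_complex_finite[OF K] \<sigma>' by (intro psubset_card_mono) auto
      show "finite_complex ?K1"
      proof (rule finite_complex_subset[OF K])
        fix S T assume S: "S \<in> ?K1" and T: "T \<subseteq> S"
        have "\<not> \<sigma> \<subseteq> T" using free[of S] S T by blast
        then show "T \<in> ?K1" using finite_complex_face[OF K _ T] S by auto
      qed auto
      show "K' \<subseteq> ?K1" using sub \<sigma>' t\<sigma> by auto
      show "insert (v S) S \<in> ?K1 - K' \<and> S - {v S} \<in> ?K1 - K' \<and>
                   v (insert (v S) S) = v S \<and> v (S - {v S}) = v S" if "S \<in> ?K1 - K'" for S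
      proof -
        have S: "S \<in> K - K'" "S \<noteq> \<sigma>" "S \<noteq> insert ?w \<sigma>" using that by auto
        note tS = toggle[OF S(1)]
        have *: "S = \<sigma> \<or> S = insert ?w \<sigma>" 
          if "R \<in> {\<sigma>, insert ?w \<sigma>}" "R \<in> {insert (v S) S, S - {v S}}" for R
        proof -
          have "v R = ?w" using that(1) t\<sigma> by auto
          moreover have "v R = v S" using that(2) tS by auto
          ultimately have "v S = ?w" by simp
          then have "R - {?w} = S - {?w}" using that(2) by auto
          moreover have "R - {?w} = \<sigma>" using that(1) \<sigma>'(3) by auto
          ultimately have "S - {?w} = \<sigma>" by simp
          then show ?thesis by (cases "?w \<in> S") auto
        qed
        show ?thesis using * S(2,3) tS by blast
      qed
    qed (use K' less.prems(4) acyclic in auto)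
    finally show ?thesis .
  qed
qed

section \<open>Collapsing a contractible subspace\<close>

text \<open>The usual argument that \<open>X \<rightarrow> X/A\<close> is a homotopy equivalence when a contraction of \<open>A\<close> extends to a
  homotopy \<open>G\<close> of \<open>X\<close>. The space \<open>W\<close> plays the role of \<open>X/A\<close>. The end map of \<open>G\<close> is constant on \<open>A\<close>
  and therefore factors through \<open>W\<close>, which gives the homotopy inverse \<open>g\<close>; \<open>G\<close> itself connects the identity
  to \<open>g \<circ> f\<close>. As \<open>G\<close> preserves \<open>A\<close>, it also descends to a homotopy of \<open>W\<close> from the identity to
  \<open>f \<circ> g\<close>; its continuity holds because the product of \<open>f\<close> with the compact interval is again a map from a
  compact space onto a Hausdorff space, hence a quotient map.\<close>

lemma contractible_quotient_homotopy_equivalent: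
  assumes X: "compact_space X" and W: "Hausdorff_space W"
    and f: "continuous_map X W f" "f ` topspace X = topspace W"
    and fibres: "\<And>x y. \<lbrakk>x \<in> topspace X; y \<in> topspace X; f x = f y\<rbrakk> \<Longrightarrow> x = y \<or> x \<in> A \<and> y \<in> A"
    and const: "\<And>x y. \<lbrakk>x \<in> A; y \<in> A\<rbrakk> \<Longrightarrow> f x = f y"
    and G: "continuous_map (prod_topology (top_of_set {0..1::real}) X) X G"
    and G0: "\<And>x. x \<in> topspace X \<Longrightarrow> G (0, x) = x"
    and GA: "\<And>s a. \<lbrakk>0 \<le> s; s \<le> 1; a \<in> A\<rbrakk> \<Longrightarrow> G (s, a) \<in> A"
    and G1: "\<And>a b. \<lbrakk>a \<in> A; b \<in> A\<rbrakk> \<Longrightarrow> G (1, a) = G (1, b)"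
  shows "X homotopy_equivalent_space W"
proof -
  let ?I = "top_of_set {0..1::real}"
  have I: "compact_space ?I" by (simp add: compact_space_subtopology)
  have q: "quotient_map X W f"
    by (rule continuous_imp_quotient_map[OF f(1) X W f(2)])
  have mapsX: "f x \<in> topspace W" if "x \<in> topspace X" for x
    using that f(2) by blast
  have G_slice: "continuous_map X X (\<lambda>x. G (s, x))" if "s \<in> {0..1}" for s
    using that by (intro continuous_map_compose[OF _ G, unfolded o_def] continuous_intros)
      (auto intro: continuous_map_pairedI)
  obtain g where g: "continuous_map W X g" "\<And>x. x \<in> topspace X \<Longrightarrow> g (f x) = G (1, x)"
  proof (rule quotient_map_lift_exists[OF q G_slice[of 1]])
    show "G (1, x) = G (1, y)" if "x \<in> topspace X" "y \<in> topspace X" "f x = f y" for x y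
      using fibres[OF that] G1 by auto
  qed auto
  let ?F = "\<lambda>z. (fst z, f (snd z))"
  have qI: "quotient_map (prod_topology ?I X) (prod_topology ?I W) ?F"
  proof (rule continuous_imp_quotient_map)
    show "continuous_map (prod_topology ?I X) (prod_topology ?I W) ?F"
      by (intro continuous_map_pairedI continuous_map_fst continuous_map_compose[OF _ f(1), unfolded o_def]
          continuous_map_snd)
    show "compact_space (prod_topology ?I X)" using I X by (simp add: compact_space_prod_topology)
    show "Hausdorff_space (prod_topology ?I W)" using W by (simp add: Hausdorff_space_prod_topology Hausdorff_space_subtopology)
    show "?F ` topspace (prod_topology ?I X) = topspace (prod_topology ?I W)"
      using f(2) by (force simp: image_iff)
  qed
  have fG: "continuous_map (prod_topology ?I X) W (\<lambda>z. f (G z))"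
    using continuous_map_compose[OF G f(1)] by (simp add: o_def)
  have resp: "f (G z) = f (G z')"
    if z: "z \<in> topspace (prod_topology ?I X)" "z' \<in> topspace (prod_topology ?I X)" "?F z = ?F z'" for z z'
  proof -
    obtain s x s' y where zz: "z = (s, x)" "z' = (s', y)" by (cases z; cases z')
    with z have *: "s' = s" "s \<in> {0..1}" "x \<in> topspace X" "y \<in> topspace X" "f x = f y" by auto
    from fibres[OF *(3-5)] show ?thesis
      using const GA *(1,2) by (auto simp: zz)
  qed
  obtain H where H: "continuous_map (prod_topology ?I W) W H"
      "\<And>z. z \<in> topspace (prod_topology ?I X) \<Longrightarrow> H (?F z) = f (G z)"
    by (rule quotient_map_lift_exists[OF qI fG resp]) blast+
  have HF: "H (s, f x) = f (G (s, x))" if "s \<in> {0..1}" "x \<in> topspace X" for s x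
    using H(2)[of "(s, x)"] that by simp
  have "homotopic_with (\<lambda>x. True) X X id (g \<circ> f)"
  proof (rule iffD2[OF homotopic_with])
    show "\<exists>h. continuous_map (prod_topology ?I X) X h \<and> (\<forall>x\<in>topspace X. h (0, x) = id x) \<and>
        (\<forall>x\<in>topspace X. h (1, x) = (g \<circ> f) x) \<and> (\<forall>t\<in>{0..1}. True)"
      using G G0 g(2) by (intro exI[of _ G]) auto
  qed auto
  moreover have "homotopic_with (\<lambda>x. True) W W id (f \<circ> g)"
  proof (rule iffD2[OF homotopic_with])
    have "H (0, w) = w" "H (1, w) = f (g w)" if "w \<in> topspace W" for w
    proof -
      have "w \<in> f ` topspace X" using that by (simp add: f(2))
      then obtain x where x: "x \<in> topspace X" "w = f x" by blast
      then show "H (0, w) = w" "H (1, w) = f (g w)"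
        using HF[of 0 x] HF[of 1 x] G0[of x] g(2)[of x] by simp_all
    qed
    then show "\<exists>h. continuous_map (prod_topology ?I W) W h \<and> (\<forall>x\<in>topspace W. h (0, x) = id x) \<and>
        (\<forall>x\<in>topspace W. h (1, x) = (f \<circ> g) x) \<and> (\<forall>t\<in>{0..1}. True)"
      using H(1) by (intro exI[of _ H]) auto
  qed simp
  ultimately show ?thesis
    unfolding homotopy_equivalent_space_def using f(1) g(1) by (meson homotopic_with_symD)
qed

section \<open>Wedges of spheres\<close>

definition base_point :: "nat \<Rightarrow> real" where
  "base_point = (\<lambda>i. if i = 0 then 1 else 0)"

definition wedge_inclusion :: "nat \<Rightarrow> (nat \<Rightarrow> real) \<Rightarrow> (nat \<times> (nat \<Rightarrow> real)) option" where
  "wedge_inclusion i x = (if x = base_point then None else Some (i, x))"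

lemma base_point_in_nsphere: "base_point \<in> topspace (nsphere m)"
  by (simp add: base_point_def in_topspace_nsphere)

lemma wedge_of_spheres_eq:
  "wedge_of_spheres r m =
     quotient_topology (sum_topology (\<lambda>_. nsphere m) {..<r}) (\<lambda>(i, x). wedge_inclusion i x)"
  by (simp add: wedge_of_spheres_def wedge_sum_def wedge_inclusion_def base_point_def)

lemma topspace_wedge_of_spheres:
  "topspace (wedge_of_spheres r m) = (\<Union>i<r. wedge_inclusion i ` topspace (nsphere m))"
  by (auto simp: wedge_of_spheres_eq topspace_quotient_topology)

lemma continuous_map_wedge_inclusion:
  assumes "i < r"
  shows "continuous_map (nsphere m) (wedge_of_spheres r m) (wedge_inclusion i)"
proof -
  have "continuous_map (nsphere m) (wedge_of_spheres r m)
      ((\<lambda>(i, x). wedge_inclusion i x) \<circ> (\<lambda>x. (i, x)))"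
    unfolding wedge_of_spheres_eq using assms
    by (intro continuous_map_compose[OF continuous_map_component_injection[of i "{..<r}"]]
        quotient_imp_continuous_map quotient_map_quotient_topology) auto
  then show ?thesis by (simp add: o_def)
qed

definition wedge_projection :: "nat \<Rightarrow> (nat \<times> (nat \<Rightarrow> real)) option \<Rightarrow> nat \<Rightarrow> real" where
  "wedge_projection i w = (case w of None \<Rightarrow> base_point | Some (j, x) \<Rightarrow> if j = i then x else base_point)"

lemma wedge_projection_inclusion:
  "wedge_projection i (wedge_inclusion j x) = (if j = i then x else base_point)"
  by (simp add: wedge_projection_def wedge_inclusion_def)

lemma continuous_map_wedge_projection:
  "continuous_map (wedge_of_spheres r m) (nsphere m) (wedge_projection i)"
  unfolding wedge_of_spheres_eq
proof (rule continuous_compose_quotient_map[OF quotient_map_quotient_topology])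
  have "continuous_map (nsphere m) (nsphere m) (\<lambda>x. if j = i then x else base_point)" for j
    by (cases "j = i") (auto simp: base_point_in_nsphere)
  then show "continuous_map (sum_topology (\<lambda>_. nsphere m) {..<r}) (nsphere m)
      (wedge_projection i \<circ> (\<lambda>(i, x). wedge_inclusion i x))"
    unfolding continuous_map_def openin_sum_topology
    using base_point_in_nsphere[of m]
    by (auto simp: wedge_projection_inclusion Pi_iff)
qed

lemma Hausdorff_space_nsphere: "Hausdorff_space (nsphere m)"
  unfolding nsphere
  by (intro Hausdorff_space_subtopology) (simp add: Hausdorff_space_product_topology)

lemma Hausdorff_space_wedge_of_spheres: "Hausdorff_space (wedge_of_spheres r m)"
  unfolding Hausdorff_space_def
proof (intro allI impI)
  fix v w
  assume vw: "v \<in> topspace (wedge_of_spheres r m) \<and> w \<in> topspace (wedge_of_spheres r m) \<and> v \<noteq> w"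
  \<comment> \<open>The projections to the spheres separate the points of the wedge.\<close>
  have "\<exists>i. wedge_projection i v \<noteq> wedge_projection i w"
  proof (rule ccontr)
    assume "\<not> ?thesis"
    then have eq: "wedge_projection i v = wedge_projection i w" for i by blast
    obtain i x j y where "v = wedge_inclusion i x" "w = wedge_inclusion j y"
      using vw by (auto simp: topspace_wedge_of_spheres)
    with eq[of i] eq[of j] vw show False
      by (auto simp: wedge_projection_def wedge_inclusion_def split: if_splits)
  qed
  then obtain i where i: "wedge_projection i v \<noteq> wedge_projection i w" by blast
  let ?p = "wedge_projection i" and ?W = "wedge_of_spheres r m"
  have p: "continuous_map ?W (nsphere m) ?p" by (rule continuous_map_wedge_projection)
  then have "?p v \<in> topspace (nsphere m)" "?p w \<in> topspace (nsphere m)"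
    using vw continuous_map_image_subset_topspace by blast+
  then obtain U V where UV: "openin (nsphere m) U" "openin (nsphere m) V" "?p v \<in> U" "?p w \<in> V" "disjnt U V"
    using Hausdorff_space_nsphere[of m] i unfolding Hausdorff_space_def by blast
  show "\<exists>U V. openin ?W U \<and> openin ?W V \<and> v \<in> U \<and> w \<in> V \<and> disjnt U V"
    using UV vw openin_continuous_map_preimage[OF p UV(1)] openin_continuous_map_preimage[OF p UV(2)]
    by (intro exI[of _ "{x \<in> topspace ?W. ?p x \<in> U}"] exI[of _ "{x \<in> topspace ?W. ?p x \<in> V}"])
       (auto simp: disjnt_iff)
qed

lemma wedge_of_one_sphere: "wedge_of_spheres 1 m homeomorphic_space nsphere m"
proof -
  have "homeomorphic_maps (wedge_of_spheres 1 m) (nsphere m) (wedge_projection 0) (wedge_inclusion 0)"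
    unfolding homeomorphic_maps_def
    using continuous_map_wedge_projection continuous_map_wedge_inclusion[of 0 1 m]
    by (auto simp: topspace_wedge_of_spheres wedge_projection_inclusion)
  then show ?thesis by (rule homeomorphic_maps_imp_homeomorphic_space)
qed

section \<open>Mapping a simplex to a sphere\<close>

text \<open>The map below from a simplex onto a sphere is an inverse stereographic projection with the base point as
  pole. Write \<open>u\<close> for the differences \<open>x (e j) - x (e 0)\<close> and \<open>\<nu>\<close> for the least coordinate. The vector
  \<open>u / \<nu>\<close> identifies the open simplex with Euclidean space and tends to infinity at the boundary; clearing
  denominators in the projection of \<open>u / \<nu>\<close> gives a formula that makes sense for \<open>\<nu> = 0\<close> as well.
  On the simplex \<open>spread\<close> is the squared norm of \<open>u\<close>. Its second summand vanishes there; it keeps the denominators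
  positive at points of other simplices, where all coordinates in question may be zero.\<close>

definition spread :: "nat \<Rightarrow> (nat \<Rightarrow> 'v) \<Rightarrow> ('v \<Rightarrow> real) \<Rightarrow> real" where
  "spread m e x = (\<Sum>j\<le>m. (x (e j) - x (e 0))\<^sup>2) + (1 - (\<Sum>j\<le>m. x (e j)))\<^sup>2"

definition simplex_to_sphere :: "nat \<Rightarrow> (nat \<Rightarrow> 'v) \<Rightarrow> ('v \<Rightarrow> real) \<Rightarrow> nat \<Rightarrow> real" where
  "simplex_to_sphere m e x j =
     (if j = 0
      then (spread m e x - (min_coord (e ` {..m}) x)\<^sup>2) / (spread m e x + (min_coord (e ` {..m}) x)\<^sup>2)
      else if j \<le> m
      then 2 * min_coord (e ` {..m}) x * (x (e j) - x (e 0)) / (spread m e x + (min_coord (e ` {..m}) x)\<^sup>2)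
      else 0)"

lemma spread_nonneg: "0 \<le> spread m e x"
  by (simp add: spread_def sum_nonneg)

lemma spread_plus_min_pos: "0 < spread m e x + (min_coord (e ` {..m}) x)\<^sup>2"
proof (rule ccontr)
  assume neg: "\<not> ?thesis"
  have 0: "spread m e x = 0" "min_coord (e ` {..m}) x = 0"
  proof -
    have "spread m e x = 0 \<and> (min_coord (e ` {..m}) x)\<^sup>2 = 0"
      using neg spread_nonneg[of m e x] zero_le_power2[of "min_coord (e ` {..m}) x"]
      by linarith
    then show "spread m e x = 0" "min_coord (e ` {..m}) x = 0" by simp_all
  qed
  have nn: "0 \<le> (\<Sum>j\<le>m. (x (e j) - x (e 0))\<^sup>2)" "0 \<le> (1 - (\<Sum>j\<le>m. x (e j)))\<^sup>2"
    by (simp_all add: sum_nonneg)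
  with 0(1) have z: "(\<Sum>j\<le>m. (x (e j) - x (e 0))\<^sup>2) = 0" "(1 - (\<Sum>j\<le>m. x (e j)))\<^sup>2 = 0"
    unfolding spread_def by linarith+
  from z(2) have sum: "(\<Sum>j\<le>m. x (e j)) = 1" by simp
  have eq: "x (e j) = x (e 0)" if "j \<le> m" for j
  proof -
    have "(x (e j) - x (e 0))\<^sup>2 \<le> (\<Sum>j\<le>m. (x (e j) - x (e 0))\<^sup>2)"
      using that by (intro member_le_sum) auto
    then show ?thesis unfolding z(1) by simp
  qed
  obtain v where v: "v \<in> e ` {..m}" "x v = min_coord (e ` {..m}) x"
    by (rule min_coord_attained[of "e ` {..m}" x]) auto
  from v(1) obtain i where i: "i \<le> m" "v = e i" by blast
  then have "x (e 0) = 0" using eq[of i] 0(2) v(2) by simp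
  then have "x (e j) = 0" if "j \<le> m" for j using eq[OF that] by simp
  then have "(\<Sum>j\<le>m. x (e j)) = 0" by (intro sum.neutral) simp
  with sum show False by simp
qed

lemma continuous_on_simplex_to_sphere: "continuous_on S (simplex_to_sphere m e)"
proof (rule continuous_on_coordinatewise_then_product)
  fix j
  have c: "continuous_on S (\<lambda>x. x v)" for v
    by (rule continuous_on_product_coordinates[THEN continuous_on_subset]) simp
  have \<rho>: "continuous_on S (spread m e)"
    unfolding spread_def[abs_def]
    by (intro continuous_on_add continuous_on_sum continuous_on_power continuous_on_diff c continuous_on_const)
  have \<nu>: "continuous_on S (min_coord (e ` {..m}))"
    using continuous_on_min_coord[of "e ` {..m}" S "\<lambda>x. x"] by (simp add: continuous_on_id)
  note ne = spread_plus_min_pos[THEN less_imp_neq, THEN not_sym]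
  show "continuous_on S (\<lambda>x. simplex_to_sphere m e x j)"
    unfolding simplex_to_sphere_def
    by (cases "j = 0"; cases "j \<le> m")
       (simp_all add: ne \<rho> \<nu> c continuous_on_divide continuous_on_add continuous_on_diff
          continuous_on_power continuous_on_mult continuous_on_const)
qed

lemma simplex_to_sphere_boundary:
  assumes "min_coord (e ` {..m}) x = 0"
  shows "simplex_to_sphere m e x = base_point"
  using assms spread_plus_min_pos[of m e x]
  by (auto simp: simplex_to_sphere_def base_point_def fun_eq_iff)

lemma simplex_to_sphere_in_nsphere:
  assumes "(\<Sum>j\<le>m. x (e j)) = 1"
  shows "simplex_to_sphere m e x \<in> topspace (nsphere m)"
proof -
  let ?\<nu> = "min_coord (e ` {..m}) x" and ?\<rho> = "spread m e x" and ?f = "simplex_to_sphere m e x"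
  have pos: "0 < ?\<rho> + ?\<nu>\<^sup>2" by (rule spread_plus_min_pos)
  have \<rho>: "?\<rho> = (\<Sum>j\<le>m. (x (e j) - x (e 0))\<^sup>2)" using assms by (simp add: spread_def)
  have "(\<Sum>j\<le>m. (?f j)\<^sup>2) = (?f 0)\<^sup>2 + (\<Sum>j\<in>{..m} - {0}. (?f j)\<^sup>2)"
    by (subst sum.remove[of _ 0]) auto
  also have "(\<Sum>j\<in>{..m} - {0}. (?f j)\<^sup>2) =
      (\<Sum>j\<in>{..m} - {0}. (x (e j) - x (e 0))\<^sup>2) * (2 * ?\<nu> / (?\<rho> + ?\<nu>\<^sup>2))\<^sup>2"
    unfolding sum_distrib_right
    by (intro sum.cong) (auto simp: simplex_to_sphere_def power_divide power_mult_distrib)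
  also have "(\<Sum>j\<in>{..m} - {0}. (x (e j) - x (e 0))\<^sup>2) = ?\<rho>"
    unfolding \<rho> by (subst (2) sum.remove[of _ 0]) auto
  also have "(?f 0)\<^sup>2 + ?\<rho> * (2 * ?\<nu> / (?\<rho> + ?\<nu>\<^sup>2))\<^sup>2 =
      ((?\<rho> - ?\<nu>\<^sup>2)\<^sup>2 + ?\<rho> * (2 * ?\<nu>)\<^sup>2) / (?\<rho> + ?\<nu>\<^sup>2)\<^sup>2"
    by (simp add: simplex_to_sphere_def power_divide add_divide_distrib)
  also have "(?\<rho> - ?\<nu>\<^sup>2)\<^sup>2 + ?\<rho> * (2 * ?\<nu>)\<^sup>2 = (?\<rho> + ?\<nu>\<^sup>2)\<^sup>2"
    by (simp add: power2_eq_square algebra_simps)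
  also have "\<dots> / (?\<rho> + ?\<nu>\<^sup>2)\<^sup>2 = 1" using pos by simp
  finally show ?thesis
    by (auto simp: nsphere simplex_to_sphere_def)
qed

text \<open>Stereographic projection recovers \<open>u / \<nu>\<close>.\<close>

lemma simplex_to_sphere_ratio:
  assumes "min_coord (e ` {..m}) x > 0" "j \<le> m"
  shows "simplex_to_sphere m e x 0 < 1"
    and "(x (e j) - x (e 0)) / min_coord (e ` {..m}) x =
          (if j = 0 then 0 else simplex_to_sphere m e x j / (1 - simplex_to_sphere m e x 0))"
proof -
  let ?\<nu> = "min_coord (e ` {..m}) x" and ?\<rho> = "spread m e x" and ?f = "simplex_to_sphere m e x"
  have pos: "0 < ?\<rho> + ?\<nu>\<^sup>2" by (rule spread_plus_min_pos)
  have f0: "1 - ?f 0 = 2 * ?\<nu>\<^sup>2 / (?\<rho> + ?\<nu>\<^sup>2)"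
    using pos by (simp add: simplex_to_sphere_def field_simps)
  moreover have "0 < 2 * ?\<nu>\<^sup>2 / (?\<rho> + ?\<nu>\<^sup>2)"
    using pos assms(1) by simp
  ultimately show "?f 0 < 1" by linarith
  show "(x (e j) - x (e 0)) / ?\<nu> = (if j = 0 then 0 else ?f j / (1 - ?f 0))"
  proof (cases "j = 0")
    case False
    then have "?f j = 2 * ?\<nu> * (x (e j) - x (e 0)) / (?\<rho> + ?\<nu>\<^sup>2)"
      using assms(2) by (simp add: simplex_to_sphere_def)
    then show ?thesis
      using False pos assms(1) by (simp add: f0 power2_eq_square)
  qed simp
qed

text \<open>A point is determined by its ratios \<open>u / \<nu>\<close>: the smallest of them belongs to a coordinate equal to \<open>\<nu>\<close>,
  which yields \<open>x (e 0) / \<nu>\<close> and thereby all \<open>x (e j) / \<nu>\<close>, and \<open>\<nu>\<close> itself follows because the coordinates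
  sum to one.\<close>

lemma simplex_to_sphere_inj:
  assumes x: "(\<Sum>j\<le>m. x (e j)) = 1" "min_coord (e ` {..m}) x > 0"
    and y: "(\<Sum>j\<le>m. y (e j)) = 1" "min_coord (e ` {..m}) y > 0"
    and eq: "simplex_to_sphere m e x = simplex_to_sphere m e y" and j: "j \<le> m"
  shows "x (e j) = y (e j)"
proof -
  define \<nu> where "\<nu> = min_coord (e ` {..m})"
  have pos: "0 < \<nu> x" "0 < \<nu> y" using x y by (auto simp: \<nu>_def)
  have ratio: "(x (e j) - x (e 0)) / \<nu> x = (y (e j) - y (e 0)) / \<nu> y" if "j \<le> m" for j
    using simplex_to_sphere_ratio(2)[OF x(2) that] simplex_to_sphere_ratio(2)[OF y(2) that] eq
    by (simp add: \<nu>_def)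
  have le: "b (e 0) / \<nu> b \<le> a (e 0) / \<nu> a"
    if ab: "0 < \<nu> a" "0 < \<nu> b" and "\<And>j. j \<le> m \<Longrightarrow> (a (e j) - a (e 0)) / \<nu> a = (b (e j) - b (e 0)) / \<nu> b"
    for a b :: "'a \<Rightarrow> real"
  proof -
    obtain v where v: "v \<in> e ` {..m}" "b v = \<nu> b"
      unfolding \<nu>_def by (rule min_coord_attained[of "e ` {..m}" b]) auto
    from v(1) obtain i where "i \<le> m" "v = e i" by blast
    with v(2) have i: "i \<le> m" "b (e i) = \<nu> b" by simp_all
    have "\<nu> a \<le> a (e i)" unfolding \<nu>_def using i(1) by (intro min_coord_le) auto
    then have "1 \<le> a (e i) / \<nu> a" using ab by simp
    moreover have "b (e i) / \<nu> b = 1" using i(2) ab by simp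
    ultimately show ?thesis using that(3)[OF i(1)] by (simp add: diff_divide_distrib)
  qed
  have "x (e 0) / \<nu> x = y (e 0) / \<nu> y"
    using le[of x y] le[of y x] pos ratio by (intro antisym) simp_all
  then have quot: "x (e j) / \<nu> x = y (e j) / \<nu> y" if "j \<le> m" for j
    using ratio[OF that] by (simp add: diff_divide_distrib)
  then have "(\<Sum>j\<le>m. x (e j)) / \<nu> x = (\<Sum>j\<le>m. y (e j)) / \<nu> y"
    unfolding sum_divide_distrib by (intro sum.cong) auto
  then have "\<nu> x = \<nu> y" using x(1) y(1) pos by simp
  with quot[OF j] pos show ?thesis by simp
qed

text \<open>Away from the pole, \<open>z\<close> is the inverse stereographic projection of the vector \<open>w\<close> below. The point with
  \<open>u / \<nu> = w\<close> has coordinates proportional to \<open>w j + 1 - min w\<close>.\<close>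

lemma simplex_to_sphere_surj:
  assumes e: "inj_on e {..m}" and z: "z \<in> topspace (nsphere m)" "z \<noteq> base_point"
  obtains x where "\<And>v. 0 \<le> x v" "\<And>v. v \<notin> e ` {..m} \<Longrightarrow> x v = 0" "(\<Sum>j\<le>m. x (e j)) = 1"
    "min_coord (e ` {..m}) x > 0" "simplex_to_sphere m e x = z"
proof -
  have zs: "(\<Sum>j\<le>m. (z j)\<^sup>2) = 1" "\<And>j. m < j \<Longrightarrow> z j = 0"
    using z(1) by (auto simp: nsphere)
  have z0: "(z 0)\<^sup>2 + (\<Sum>j\<in>{..m} - {0}. (z j)\<^sup>2) = 1"
    using zs(1) by (subst (asm) sum.remove[of _ 0]) auto
  have "z 0 < 1"
  proof (rule ccontr)
    assume "\<not> z 0 < 1"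
    then have "1 \<le> (z 0)\<^sup>2" by simp
    moreover have "0 \<le> (\<Sum>j\<in>{..m} - {0}. (z j)\<^sup>2)" by (simp add: sum_nonneg)
    ultimately have *: "(z 0)\<^sup>2 = 1" "(\<Sum>j\<in>{..m} - {0}. (z j)\<^sup>2) = 0" using z0 by linarith+
    then have "z 0 = 1" using \<open>\<not> z 0 < 1\<close> by (auto simp: power2_eq_1_iff)
    moreover have "z j = 0" if "j \<noteq> 0" for j
      using * that zs(2)[of j] by (cases "j \<le> m") (auto simp: sum_nonneg_eq_0_iff)
    ultimately have "z = base_point" by (auto simp: base_point_def)
    with z(2) show False by simp
  qed
  define w where "w = (\<lambda>j. if j = 0 then 0 else z j / (1 - z 0))"
  define \<mu> where "\<mu> = Min (w ` {..m})"
  define N where "N = (\<Sum>j\<le>m. w j + 1 - \<mu>)"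
  define x where "x = (\<lambda>v. if v \<in> e ` {..m} then (w (inv_into {..m} e v) + 1 - \<mu>) / N else 0)"
  have \<mu>: "\<mu> \<le> w j" if "j \<le> m" for j using that by (simp add: \<mu>_def)
  have N: "N > 0" unfolding N_def
  proof (rule sum_pos)
    show "0 < w j + 1 - \<mu>" if "j \<in> {..m}" for j using \<mu>[of j] that by simp
  qed auto
  have xe: "x (e j) = (w j + 1 - \<mu>) / N" if "j \<le> m" for j
    using that e by (simp add: x_def inv_into_f_f)
  have nonneg: "0 \<le> x v" for v
  proof (cases "v \<in> e ` {..m}")
    case True
    then obtain j where "j \<le> m" "v = e j" by auto
    then show ?thesis using xe[of j] \<mu>[of j] N by simp
  qed (simp add: x_def)
  have sum: "(\<Sum>j\<le>m. x (e j)) = 1"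
  proof -
    have "(\<Sum>j\<le>m. x (e j)) = (\<Sum>j\<le>m. w j + 1 - \<mu>) / N"
      unfolding sum_divide_distrib by (intro sum.cong) (auto simp: xe)
    then show ?thesis using N by (simp add: N_def)
  qed
  have "\<mu> \<in> w ` {..m}" unfolding \<mu>_def by (rule Min_in) auto
  then obtain i where i: "i \<le> m" "w i = \<mu>" by auto
  have min: "min_coord (e ` {..m}) x = 1 / N"
    unfolding min_coord_def
  proof (rule Min_eqI)
    show "1 / N \<le> y" if "y \<in> x ` e ` {..m}" for y
      using that \<mu> N by (auto simp: xe divide_right_mono)
    show "1 / N \<in> x ` e ` {..m}"
      using xe[OF i(1)] i by (intro image_eqI[of _ _ "e i"]) auto
  qed simp
  have diff: "x (e j) - x (e 0) = w j / N" if "j \<le> m" for j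
    using xe[OF that] xe[of 0] by (simp add: w_def diff_divide_distrib add_divide_distrib)
  have w2: "(\<Sum>j\<le>m. (w j)\<^sup>2) = (1 + z 0) / (1 - z 0)"
  proof -
    have "(\<Sum>j\<le>m. (w j)\<^sup>2) = (\<Sum>j\<in>{..m} - {0}. (w j)\<^sup>2)"
      by (subst sum.remove[of _ 0]) (auto simp: w_def)
    also have "\<dots> = (\<Sum>j\<in>{..m} - {0}. (z j)\<^sup>2) / (1 - z 0)\<^sup>2"
      unfolding sum_divide_distrib by (intro sum.cong) (auto simp: w_def power_divide)
    also have "\<dots> = (1 + z 0) * (1 - z 0) / (1 - z 0)\<^sup>2"
      using z0 by (simp add: algebra_simps power2_eq_square)
    also have "\<dots> = (1 + z 0) / (1 - z 0)"
      using \<open>z 0 < 1\<close> by (simp add: power2_eq_square)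
    finally show ?thesis .
  qed
  have "spread m e x = (\<Sum>j\<le>m. (w j / N)\<^sup>2)"
    unfolding spread_def using sum diff by simp
  also have "\<dots> = ((1 + z 0) / (1 - z 0)) / N\<^sup>2"
    by (simp add: power_divide sum_divide_distrib[symmetric] w2)
  finally have \<rho>: "spread m e x = ((1 + z 0) / (1 - z 0)) / N\<^sup>2" .
  have den: "spread m e x + (1 / N)\<^sup>2 = 2 / ((1 - z 0) * N\<^sup>2)"
    unfolding \<rho> using N \<open>z 0 < 1\<close> by (simp add: field_simps power_divide)
  have "simplex_to_sphere m e x j = z j" for j
  proof -
    consider "j = 0" | "0 < j" "j \<le> m" | "m < j" by linarith
    then show ?thesis
    proof cases
      case 1
      have "spread m e x - (1 / N)\<^sup>2 = 2 * z 0 / ((1 - z 0) * N\<^sup>2)"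
        unfolding \<rho> using N \<open>z 0 < 1\<close> by (simp add: field_simps power_divide)
      with den 1 show ?thesis
        using N \<open>z 0 < 1\<close> by (simp add: simplex_to_sphere_def min)
    next
      case 2
      then have "simplex_to_sphere m e x j = 2 * (1 / N) * (w j / N) / (spread m e x + (1 / N)\<^sup>2)"
        using diff[of j] by (simp add: simplex_to_sphere_def min)
      also have "\<dots> = w j * (1 - z 0)"
        unfolding den using N \<open>z 0 < 1\<close> by (simp add: field_simps power2_eq_square)
      finally show ?thesis using 2 \<open>z 0 < 1\<close> by (simp add: w_def)
    qed (use zs(2) in \<open>simp add: simplex_to_sphere_def\<close>)
  qed
  then show ?thesis
    using that[of x] nonneg sum min N by (auto simp: x_def)
qed

section \<open>Attaching facets to a contractible complex\<close>

text \<open>A complex \<open>K\<close> obtained from the subcomplex \<open>K - C\<close> by attaching simplices of equal dimension. Since they have equal size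
  and \<open>K - C\<close> is closed under taking faces, the members of \<open>C\<close> are maximal faces of \<open>K\<close>.\<close>

locale attached_facets =
  fixes K C :: "'v set set" and m :: nat
  assumes K: "finite_complex K" and L: "finite_complex (K - C)" and CK: "C \<subseteq> K"
    and card_C: "\<And>\<tau>. \<tau> \<in> C \<Longrightarrow> card \<tau> = Suc m"
begin

lemma facet_finite: "\<tau> \<in> C \<Longrightarrow> finite \<tau>"
  and facet_nonempty: "\<tau> \<in> C \<Longrightarrow> \<tau> \<noteq> {}"
  using card_C by (metis card.infinite nat.distinct(1), fastforce)

lemma finite_C: "finite C"
  using finite_complex_finite[OF K] CK finite_subset by blast

lemma facet_maximal:
  assumes "\<tau> \<in> C" "S \<in> K" "\<tau> \<subseteq> S"
  shows "S = \<tau>"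
proof -
  have "S \<in> C"
    using finite_complex_face[OF L, of S \<tau>] assms by blast
  then show ?thesis
    using assms(1,3) card_C facet_finite by (metis card_subset_eq)
qed

lemma subset_points: "realization_points (K - C) \<subseteq> realization_points K"
  by (intro realization_points_mono) blast

lemma min_coord_facet_nonneg: "x \<in> realization_points K \<Longrightarrow> \<tau> \<in> C \<Longrightarrow> 0 \<le> min_coord \<tau> x"
  by (simp add: min_coord_nonneg facet_finite facet_nonempty)

lemma min_coord_facet_pos_iff:
  assumes "x \<in> realization_points K" "\<tau> \<in> C"
  shows "0 < min_coord \<tau> x \<longleftrightarrow> {v. x v \<noteq> 0} = \<tau>"
  using min_coord_pos_iff[OF assms(1) facet_finite facet_nonempty, OF assms(2,2)]
    facet_maximal[OF assms(2) realization_points_support[OF assms(1)]] by blast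

text \<open>At most one summand is nonzero at any point of the realization. The sum measures how deep the point lies
  in the interior of an attached simplex and vanishes exactly on the lower complex.\<close>

definition interior_coord :: "('v \<Rightarrow> real) \<Rightarrow> real" where
  "interior_coord x = (\<Sum>\<tau>\<in>C. min_coord \<tau> x)"

lemma points_cases:
  assumes "x \<in> realization_points K"
  obtains (lower) "x \<in> realization_points (K - C)" "\<And>\<tau>. \<tau> \<in> C \<Longrightarrow> min_coord \<tau> x = 0" "interior_coord x = 0"
  | (interior) \<tau> where "\<tau> \<in> C" "{v. x v \<noteq> 0} = \<tau>" "0 < min_coord \<tau> x" "interior_coord x = min_coord \<tau> x"
      "\<And>\<tau>'. \<tau>' \<in> C \<Longrightarrow> \<tau>' \<noteq> \<tau> \<Longrightarrow> min_coord \<tau>' x = 0"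
proof (cases "{v. x v \<noteq> 0} \<in> C")
  case True
  define \<tau> where "\<tau> = {v. x v \<noteq> 0}"
  have \<tau>: "\<tau> \<in> C" using True by (simp add: \<tau>_def)
  have pos: "0 < min_coord \<tau> x" using min_coord_facet_pos_iff[OF assms \<tau>] by (simp add: \<tau>_def)
  have 0: "min_coord \<tau>' x = 0" if "\<tau>' \<in> C" "\<tau>' \<noteq> \<tau>" for \<tau>'
  proof -
    have "\<not> 0 < min_coord \<tau>' x"
      using min_coord_facet_pos_iff[OF assms that(1)] that(2) unfolding \<tau>_def by simp
    then show ?thesis using min_coord_facet_nonneg[OF assms that(1)] by linarith
  qed
  have "interior_coord x = min_coord \<tau> x"
    unfolding interior_coord_def using \<tau> finite_C 0 by (simp add: sum.remove)
  then show ?thesis using interior[OF \<tau>] pos 0 by (simp add: \<tau>_def)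
next
  case False
  have 0: "min_coord \<tau> x = 0" if "\<tau> \<in> C" for \<tau>
    using min_coord_facet_pos_iff[OF assms that] min_coord_facet_nonneg[OF assms that] False that
    by fastforce
  then have "interior_coord x = 0" by (simp add: interior_coord_def)
  moreover have "x \<in> realization_points (K - C)" using assms False by (simp add: realization_points_def)
  ultimately show ?thesis using lower 0 by blast
qed

lemma interior_coord_nonneg: "x \<in> realization_points K \<Longrightarrow> 0 \<le> interior_coord x"
  by (simp add: interior_coord_def min_coord_facet_nonneg sum_nonneg)

lemma interior_coord_lower: "x \<in> realization_points (K - C) \<Longrightarrow> interior_coord x = 0"
proof -
  assume x: "x \<in> realization_points (K - C)"
  then have xK: "x \<in> realization_points K" using subset_points by blast
  from xK show ?thesis
  proof (cases rule: points_cases)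
    case (interior \<tau>)
    then show ?thesis using realization_points_support[OF x] by simp
  qed
qed

text \<open>This lowers all coordinates of an attached simplex by up to \<open>c\<close>, but never below zero, and rescales to
  total mass one. Points with \<open>interior_coord x \<le> c\<close> are thus projected radially from the barycenter to
  the boundary of their simplex, while the remaining core is stretched over the whole simplex.\<close>

definition push :: "real \<Rightarrow> ('v \<Rightarrow> real) \<Rightarrow> 'v \<Rightarrow> real" where
  "push c x u = (x u - (\<Sum>\<tau>\<in>C. if u \<in> \<tau> then min (min_coord \<tau> x) c else 0)) /
                (1 - real (Suc m) * min (interior_coord x) c)"

lemma push_lower:
  assumes "x \<in> realization_points (K - C)" "0 \<le> c"
  shows "push c x = x"
proof -
  have xK: "x \<in> realization_points K" using assms subset_points by blast
  from xK show ?thesis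
  proof (cases rule: points_cases)
    case lower
    then have "(\<Sum>\<tau>\<in>C. if u \<in> \<tau> then min (min_coord \<tau> x) c else 0) = 0" for u
      using assms(2) by (intro sum.neutral) auto
    with lower assms(2) show ?thesis by (simp add: push_def fun_eq_iff)
  next
    case (interior \<tau>)
    then show ?thesis using realization_points_support[OF assms(1)] by simp
  qed
qed

lemma push_0:
  assumes "x \<in> realization_points K"
  shows "push 0 x = x"
proof -
  have "(\<Sum>\<tau>\<in>C. if u \<in> \<tau> then min (min_coord \<tau> x) 0 else 0) = 0" for u
    using min_coord_facet_nonneg[OF assms] by (intro sum.neutral) auto
  then show ?thesis 
    using interior_coord_nonneg[OF assms] by (simp add: push_def fun_eq_iff)
qed

lemma push_interior:
  assumes x: "x \<in> realization_points K" and \<tau>: "\<tau> \<in> C" "{v. x v \<noteq> 0} = \<tau>" and c: "0 \<le> c" "c * real (Suc m) \<le> 1 / 2"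
  shows "push c x \<in> realization_points K" "interior_coord x \<le> c \<Longrightarrow> push c x \<in> realization_points (K - C)"
proof -
  have pos: "0 < min_coord \<tau> x" and int: "interior_coord x = min_coord \<tau> x"
    and 0: "\<And>\<tau>'. \<tau>' \<in> C \<Longrightarrow> \<tau>' \<noteq> \<tau> \<Longrightarrow> min_coord \<tau>' x = 0"
    using points_cases[OF x] \<tau> by (metis realization_points_support Diff_iff)+
  define \<mu> where "\<mu> = min (min_coord \<tau> x) c"
  have \<mu>: "0 \<le> \<mu>" "\<mu> \<le> c" using pos c by (auto simp: \<mu>_def)
  then have "real (Suc m) * \<mu> \<le> real (Suc m) * c" by (intro mult_left_mono) auto
  moreover have "real (Suc m) * c = c * real (Suc m)" by (rule mult.commute)
  ultimately have den: "0 < 1 - real (Suc m) * \<mu>" using c(2) by linarith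
  have "(\<Sum>\<tau>'\<in>C. if u \<in> \<tau>' then min (min_coord \<tau>' x) c else 0) = (if u \<in> \<tau> then \<mu> else 0)" for u
  proof -
    have "(\<Sum>\<tau>'\<in>C - {\<tau>}. if u \<in> \<tau>' then min (min_coord \<tau>' x) c else 0) = 0"
      using 0 c(1) by (intro sum.neutral) auto
    then show ?thesis using \<tau>(1) finite_C by (simp add: sum.remove \<mu>_def)
  qed
  then have push: "push c x u = (x u - (if u \<in> \<tau> then \<mu> else 0)) / (1 - real (Suc m) * \<mu>)" for u
    by (simp only: push_def int \<mu>_def)
  have fin: "finite \<tau>" using \<tau>(1) by (rule facet_finite)
  have nonneg: "0 \<le> push c x u" for u
    using min_coord_le[OF fin, of u x] den realization_points_nonneg[OF x, of u] 
    by (auto simp: push \<mu>_def)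
  have out: "push c x u = 0" if "u \<notin> \<tau>" for u
    using that \<tau>(2) by (auto simp: push)
  have "sum (push c x) \<tau> = (\<Sum>u\<in>\<tau>. x u - \<mu>) / (1 - real (Suc m) * \<mu>)"
    unfolding sum_divide_distrib by (intro sum.cong) (auto simp: push)
  also have "\<dots> = 1"
    using realization_points_sum[OF x fin] \<tau>(2) card_C[OF \<tau>(1)] den by (simp add: sum_subtractf)
  finally have sum: "sum (push c x) \<tau> = 1" .
  have sup: "{u. push c x u \<noteq> 0} \<subseteq> \<tau>" using out by blast
  then have supK: "{u. push c x u \<noteq> 0} \<in> K"
    using finite_complex_face[OF K] \<tau>(1) CK by blast
  then show "push c x \<in> realization_points K"
    using fin nonneg out sum by (intro realization_pointsI[of \<tau>]) auto
  assume "interior_coord x \<le> c"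
  then have \<mu>_eq: "\<mu> = min_coord \<tau> x" by (simp add: \<mu>_def int)
  obtain u where u: "u \<in> \<tau>" "x u = min_coord \<tau> x"
    using min_coord_attained[OF fin facet_nonempty[OF \<tau>(1)]] .
  then have "push c x u = 0" by (simp add: push \<mu>_eq)
  then have "{u. push c x u \<noteq> 0} \<subset> \<tau>" using sup u(1) by blast
  then have "card {u. push c x u \<noteq> 0} < Suc m"
    using card_C[OF \<tau>(1)] fin by (metis psubset_card_mono)
  then have "{u. push c x u \<noteq> 0} \<notin> C" using card_C by fastforce
  then show "push c x \<in> realization_points (K - C)"
    using supK fin nonneg out sum by (intro realization_pointsI[of \<tau>]) auto
qed

lemma push_in:
  assumes "x \<in> realization_points K" "0 \<le> c" "c * real (Suc m) \<le> 1 / 2"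
  shows "push c x \<in> realization_points K"
  using assms(1)
proof (cases rule: points_cases)
  case lower
  then show ?thesis using push_lower[of x c] assms by simp
next
  case (interior \<tau>)
  then show ?thesis using push_interior(1)[OF assms(1) _ _ assms(2,3)] by blast
qed

lemma push_in_lower:
  assumes "x \<in> realization_points K" "0 \<le> c" "c * real (Suc m) \<le> 1 / 2" "interior_coord x \<le> c"
  shows "push c x \<in> realization_points (K - C)"
  using assms(1)
proof (cases rule: points_cases)
  case lower
  then show ?thesis using push_lower[of x c] assms by simp
next
  case (interior \<tau>)
  then show ?thesis using push_interior(2)[OF assms(1) _ _ assms(2,3,4)] by blast
qed

lemma continuous_on_interior_coord:
  assumes "continuous_on A g"
  shows "continuous_on A (\<lambda>z. interior_coord (g z))"
  unfolding interior_coord_def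
  by (intro continuous_on_sum continuous_on_min_coord facet_finite facet_nonempty assms)

lemma continuous_on_push:
  "continuous_on ({0..1} \<times> realization_points K) (\<lambda>z. push (fst z / (2 * real (Suc m))) (snd z))"
proof (rule continuous_on_coordinatewise_then_product)
  fix u
  let ?c = "\<lambda>z::real \<times> ('v \<Rightarrow> real). fst z / (2 * real (Suc m))" and ?A = "{0..1} \<times> realization_points K"
  have c: "continuous_on ?A ?c"
    by (intro continuous_on_divide continuous_on_fst continuous_on_id continuous_on_const) auto
  have num: "continuous_on ?A (\<lambda>z. if u \<in> \<tau> then min (min_coord \<tau> (snd z)) (?c z) else 0)" if "\<tau> \<in> C" for \<tau>
    using that c by (cases "u \<in> \<tau>")
      (simp_all add: continuous_on_min continuous_on_min_coord facet_finite facet_nonempty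
        continuous_on_snd continuous_on_id continuous_on_const)
  have ne: "1 - real (Suc m) * min (interior_coord (snd z)) (?c z) \<noteq> 0" if "z \<in> ?A" for z
  proof -
    have "real (Suc m) * min (interior_coord (snd z)) (?c z) \<le> real (Suc m) * ?c z"
      by (intro mult_left_mono) auto
    also have "\<dots> = fst z / 2" by (simp del: of_nat_Suc)
    also have "\<dots> < 1" using that by auto
    finally show ?thesis by linarith
  qed
  show "continuous_on ?A (\<lambda>z. push (?c z) (snd z) u)"
    unfolding push_def
    by (intro continuous_on_divide continuous_on_diff continuous_on_sum continuous_on_mult
        continuous_on_const continuous_on_coord_snd continuous_on_min continuous_on_interior_coord
        continuous_on_snd continuous_on_id c num ballI ne)
qed

text \<open>Homotopy extension for the pair of \<open>K\<close> and \<open>K - C\<close>. At time \<open>s\<close> the outer collar of depth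
  \<open>s / q\<close> of each attached simplex is projected to the boundary, where the contraction \<open>h\<close> of the lower complex
  takes over, run for the shorter time \<open>s - q * interior_coord x\<close> the deeper the point lies.
  The constant \<open>q = 2 * Suc m\<close> keeps the collar at most half way to the barycenter, whose coordinates are
  \<open>1 / Suc m\<close>; so the rescaling in \<open>push\<close> never divides by zero.\<close>

lemma lower_contraction_extends:
  assumes "contractible_space (geometric_realization (K - C))"
  obtains G p where "continuous_map (prod_topology (top_of_set {0..1::real}) (geometric_realization K))
        (geometric_realization K) G"
    "\<And>x. x \<in> realization_points K \<Longrightarrow> G (0, x) = x"
    "\<And>s x. \<lbrakk>0 \<le> s; s \<le> 1; x \<in> realization_points (K - C)\<rbrakk> \<Longrightarrow> G (s, x) \<in> realization_points (K - C)"
    "\<And>x. x \<in> realization_points (K - C) \<Longrightarrow> G (1, x) = p"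
proof -
  let ?P = "realization_points K" and ?A = "realization_points (K - C)"
  obtain p h where h: "continuous_on ({0..1::real} \<times> ?A) h" "h ` ({0..1} \<times> ?A) \<subseteq> ?A"
      "\<And>x. h (0, x) = x" "\<And>x. h (1, x) = p"
    using assms
    by (auto simp: contractible_space_def geometric_realization_eq homotopic_with_def
        continuous_map_in_subtopology image_subset_iff_funcset)
  define q where "q = 2 * real (Suc m)"
  have q: "q > 0" by (simp add: q_def)
  define G where "G = (\<lambda>z. if fst z \<le> q * interior_coord (snd z) then push (fst z / q) (snd z)
      else h (fst z - q * interior_coord (snd z), push (fst z / q) (snd z)))"
  have cq: "0 \<le> s / q" "s / q * real (Suc m) \<le> 1 / 2" if "0 \<le> s" "s \<le> 1" for s
    using that q by (auto simp: q_def simp del: of_nat_Suc)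
  have int: "continuous_on A (\<lambda>z. q * interior_coord (snd z))" for A :: "(real \<times> ('v \<Rightarrow> real)) set"
    by (intro continuous_on_mult continuous_on_const continuous_on_interior_coord continuous_on_snd continuous_on_id)
  have push: "continuous_on ({0..1} \<times> ?P) (\<lambda>z. push (fst z / q) (snd z))"
    unfolding q_def by (rule continuous_on_push)
  let ?B = "{z \<in> {0..1} \<times> ?P. q * interior_coord (snd z) \<le> fst z}"
  have pushB: "push (fst z / q) (snd z) \<in> ?A" if "z \<in> ?B" for z
    using that cq[of "fst z"] q by (intro push_in_lower) (auto simp: field_simps)
  have contG: "continuous_map (top_of_set ({0..1} \<times> ?P)) (top_of_set ?P) G"
    unfolding G_def
  proof (rule continuous_map_cases_le)
    show "continuous_map (top_of_set ({0..1} \<times> ?P)) euclideanreal fst"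
      by (simp add: continuous_on_fst continuous_on_id)
    show "continuous_map (top_of_set ({0..1} \<times> ?P)) euclideanreal (\<lambda>z. q * interior_coord (snd z))"
      unfolding continuous_map_iff_continuous
      by (intro continuous_on_mult continuous_on_const continuous_on_interior_coord
          continuous_on_snd continuous_on_id)
    have "push (fst z / q) (snd z) \<in> ?P" if "z \<in> {0..1} \<times> ?P" for z
      using that cq[of "fst z"] by (intro push_in) auto
    then show "continuous_map (subtopology (top_of_set ({0..1} \<times> ?P))
        {z \<in> topspace (top_of_set ({0..1} \<times> ?P)). fst z \<le> q * interior_coord (snd z)})
        (top_of_set ?P) (\<lambda>z. push (fst z / q) (snd z))"
      by (intro continuous_map_from_subtopology[of "top_of_set ({0..1} \<times> ?P)" "top_of_set ?P"])
        (simp add: push continuous_map_in_subtopology Pi_iff del: subtopology_UNIV)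
    have "continuous_on ?B (\<lambda>z. h (fst z - q * interior_coord (snd z), push (fst z / q) (snd z)))"
    proof (rule continuous_on_compose2[OF h(1)])
      show "continuous_on ?B (\<lambda>z. (fst z - q * interior_coord (snd z), push (fst z / q) (snd z)))"
        by (intro continuous_on_Pair continuous_on_diff continuous_on_fst continuous_on_id int
            continuous_on_subset[OF push]) auto
      show "(\<lambda>z. (fst z - q * interior_coord (snd z), push (fst z / q) (snd z))) ` ?B \<subseteq> {0..1} \<times> ?A"
      proof (intro image_subsetI SigmaI)
        fix z assume z: "z \<in> ?B"
        then have "0 \<le> q * interior_coord (snd z)"
          using q interior_coord_nonneg[of "snd z"] by auto
        then show "fst z - q * interior_coord (snd z) \<in> {0..1}" using z by auto
      qed (rule pushB)
    qed
    moreover have "h (fst z - q * interior_coord (snd z), push (fst z / q) (snd z)) \<in> ?P" if z: "z \<in> ?B" for z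
    proof -
      have "0 \<le> q * interior_coord (snd z)"
        using q interior_coord_nonneg[of "snd z"] z by auto
      then have "(fst z - q * interior_coord (snd z), push (fst z / q) (snd z)) \<in> {0..1} \<times> ?A"
        using z pushB[OF z] by auto
      then show ?thesis using h(2) subset_points by blast
    qed
    moreover have "subtopology (top_of_set ({0..1} \<times> ?P))
        {z \<in> topspace (top_of_set ({0..1} \<times> ?P)). q * interior_coord (snd z) \<le> fst z} = top_of_set ?B"
      unfolding subtopology_subtopology by (intro arg_cong[where f = top_of_set]) auto
    ultimately show "continuous_map (subtopology (top_of_set ({0..1} \<times> ?P))
        {z \<in> topspace (top_of_set ({0..1} \<times> ?P)). q * interior_coord (snd z) \<le> fst z})
        (top_of_set ?P) (\<lambda>z. h (fst z - q * interior_coord (snd z), push (fst z / q) (snd z)))"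
      by (simp add: continuous_map_in_subtopology image_subset_iff_funcset[symmetric] image_subset_iff)
  qed (simp add: h(3))
  show ?thesis
  proof (rule that[of G p])
    show "continuous_map (prod_topology (top_of_set {0..1}) (geometric_realization K)) (geometric_realization K) G"
      using contG by (simp add: geometric_realization_eq)
    show "G (0, x) = x" if "x \<in> ?P" for x
      using that interior_coord_nonneg[OF that] q push_0[OF that] by (simp add: G_def)
    show "G (s, x) \<in> ?A" if "0 \<le> s" "s \<le> 1" "x \<in> ?A" for s x
      using that interior_coord_lower[OF that(3)] push_lower[OF that(3)] h(2) q
      by (auto simp: G_def)
    show "G (1, x) = p" if "x \<in> ?A" for x
      using that interior_coord_lower[OF that] push_lower[OF that] h(4) q by (auto simp: G_def)
  qed
qed

text \<open>Collapsing the contractible lower complex to a point turns each attached simplex into a sphere. The lower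
  complex has to be inhabited: otherwise, for \<open>m = 0\<close>, the complex consists of isolated points and its quotient map misses
  the base point of the wedge.\<close>

lemma homotopy_equivalent_wedge:
  assumes "C \<noteq> {}" "contractible_space (geometric_realization (K - C))" "realization_points (K - C) \<noteq> {}"
  shows "geometric_realization K homotopy_equivalent_space wedge_of_spheres (card C) m"
proof -
  define r where "r = card C"
  have r: "0 < r" using assms(1) finite_C by (simp add: r_def card_gt_0_iff)
  let ?P = "realization_points K" and ?A = "realization_points (K - C)" and ?W = "wedge_of_spheres r m"
  obtain t where t: "bij_betw t {..<r} C"
    using ex_bij_betw_nat_finite[OF finite_C] by (auto simp: r_def atLeast0LessThan)
  then have tC: "t i \<in> C" if "i < r" for i using that by (auto simp: bij_betw_def)
  have "\<exists>e. bij_betw e {..m} (t i)" if "i < r" for i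
    using ex_bij_betw_nat_finite[OF facet_finite[OF tC[OF that]]] card_C[OF tC[OF that]]
    by (simp add: atLeast0LessThan lessThan_Suc_atMost)
  then obtain e where e: "\<And>i. i < r \<Longrightarrow> bij_betw (e i) {..m} (t i)" by metis
  have e_img: "e i ` {..m} = t i" if "i < r" for i using e[OF that] by (simp add: bij_betw_def)
  have e_inj: "inj_on (e i) {..m}" if "i < r" for i using e[OF that] by (simp add: bij_betw_def)
  have e_sum: "(\<Sum>j\<le>m. x (e i j)) = sum x (t i)" if "i < r" for i and x :: "'v \<Rightarrow> real"
    using sum.reindex_bij_betw[OF e[OF that], of x] .
  define F where "F = (\<lambda>i. simplex_to_sphere m (e i))"
  have F0: "F i x = base_point" if "i < r" "min_coord (t i) x = 0" for i x
    using simplex_to_sphere_boundary[of "e i" m x] that by (simp add: F_def e_img)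
  have sum1: "(\<Sum>j\<le>m. x (e i j)) = 1" if "i < r" "x \<in> ?P" "min_coord (t i) x > 0" for i x
    using min_coord_facet_pos_iff[OF that(2) tC[OF that(1)]] that(3)
      realization_points_sum[OF that(2) facet_finite[OF tC[OF that(1)]]] by (simp add: e_sum that(1))
  have F_in: "F i x \<in> topspace (nsphere m)" if "i < r" "x \<in> ?P" for i x
  proof (cases "min_coord (t i) x = 0")
    case True
    then show ?thesis using F0 that base_point_in_nsphere by simp
  next
    case False
    then have "0 < min_coord (t i) x" using min_coord_facet_nonneg[OF that(2) tC[OF that(1)]] by simp
    then show ?thesis unfolding F_def using sum1 that by (intro simplex_to_sphere_in_nsphere) auto
  qed
  have F_cont: "continuous_map (top_of_set ?P) (nsphere m) (F i)" if "i < r" for i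
    using continuous_on_simplex_to_sphere[of ?P m "e i"] F_in[OF that]
    by (auto simp: nsphere F_def continuous_map_in_subtopology euclidean_product_topology)
  define f where "f = (\<lambda>x. if \<exists>i<r. 0 < min_coord (t i) x
      then let i = (SOME i. i < r \<and> 0 < min_coord (t i) x) in wedge_inclusion i (F i x) else None)"
  have inc0: "wedge_inclusion i base_point = None" for i by (simp add: wedge_inclusion_def)
  have only: "min_coord (t j) x = 0" if "x \<in> ?P" "i < r" "j < r" "i \<noteq> j" "0 < min_coord (t i) x" for i j x
  proof -
    have "t i \<noteq> t j" using t that by (auto simp: bij_betw_def inj_on_def)
    then show ?thesis
      using min_coord_facet_pos_iff[OF that(1) tC] min_coord_facet_nonneg[OF that(1) tC] that(2,3,5)
      by (metis order_le_less)
  qed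
  have f_pos: "f x = wedge_inclusion i (F i x)" if "x \<in> ?P" "i < r" "0 < min_coord (t i) x" for i x
  proof -
    have "(SOME i. i < r \<and> 0 < min_coord (t i) x) = i"
      using that only by (intro some_equality) fastforce+
    then show ?thesis using that by (auto simp: f_def)
  qed
  have f_zero: "f x = None" if "\<And>i. i < r \<Longrightarrow> min_coord (t i) x = 0" for x
    using that by (auto simp: f_def)
  have f_lower: "f x = None" if "x \<in> ?A" for x
  proof (rule f_zero)
    fix i assume i: "i < r"
    have x: "x \<in> ?P" using that subset_points by blast
    show "min_coord (t i) x = 0"
      using min_coord_facet_pos_iff[OF x tC[OF i]] min_coord_facet_nonneg[OF x tC[OF i]]
        realization_points_support[OF that] tC[OF i] by fastforce
  qed
  have pos_or_lower: "(\<exists>i<r. 0 < min_coord (t i) x) \<or> x \<in> ?A" if "x \<in> ?P" for x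
    using that
  proof (cases rule: points_cases)
    case (interior \<tau>)
    then show ?thesis using t by (auto simp: bij_betw_def)
  qed simp
  \<comment> \<open>The sets \<open>T i\<close> form a finite closed cover; on each of them \<open>f\<close> is a single sphere map followed by the
     inclusion of that sphere.\<close>
  define T where "T = (\<lambda>i. {x \<in> ?P. \<forall>j\<in>{..<r} - {i}. min_coord (t j) x = 0})"
  have f_T: "f x = wedge_inclusion i (F i x)" if "i < r" "x \<in> T i" for i x
  proof -
    have x: "x \<in> ?P" using that by (simp add: T_def)
    show ?thesis
    proof (cases "min_coord (t i) x = 0")
      case True
      then have "f x = None" using that by (intro f_zero) (auto simp: T_def)
      with True show ?thesis using F0[OF that(1)] inc0 by simp
    next
      case False
      then show ?thesis using f_pos[OF x that(1)] min_coord_facet_nonneg[OF x tC[OF that(1)]] by simp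
    qed
  qed
  have f_cont: "continuous_map (top_of_set ?P) ?W f"
  proof (rule pasting_lemma_closed[of "{..<r}" _ T _ "\<lambda>i x. wedge_inclusion i (F i x)"])
    fix i assume "i \<in> {..<r}"
    then have i: "i < r" by simp
    have "T i = ?P \<inter> (\<Inter>j\<in>{..<r} - {i}. {x \<in> ?P. min_coord (t j) x \<in> {0}})" by (auto simp: T_def)
    moreover have "closedin (top_of_set ?P) {x \<in> ?P. min_coord (t j) x \<in> {0}}" if "j < r" for j
    proof -
      have "continuous_on ?P (\<lambda>x. min_coord (t j) x)"
        by (intro continuous_on_min_coord continuous_on_id facet_finite facet_nonempty tC that)
      then show ?thesis
        using continuous_closedin_preimage_constant[of ?P "min_coord (t j)" 0] by simp
    qed
    ultimately show "closedin (top_of_set ?P) (T i)"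
      by (cases "{..<r} - {i} = {}") (auto intro!: closedin_Int closedin_Inter)
    show "continuous_map (subtopology (top_of_set ?P) (T i)) ?W (\<lambda>x. wedge_inclusion i (F i x))"
      using continuous_map_compose[OF F_cont[OF i] continuous_map_wedge_inclusion[OF i]]
      by (simp add: continuous_map_from_subtopology o_def)
  next
    fix i j x assume "i \<in> {..<r}" "j \<in> {..<r}" "x \<in> topspace (top_of_set ?P) \<inter> T i \<inter> T j"
    then show "wedge_inclusion i (F i x) = wedge_inclusion j (F j x)"
      using f_T[of i x] f_T[of j x] by auto
  next
    fix x assume x: "x \<in> topspace (top_of_set ?P)"
    have "\<exists>i<r. x \<in> T i"
    proof (cases "\<exists>i<r. 0 < min_coord (t i) x")
      case True
      then obtain i where i: "i < r" "0 < min_coord (t i) x" by blast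
      then have "x \<in> T i" using x only[of x i] by (auto simp: T_def)
      with i show ?thesis by blast
    next
      case False
      then have "x \<in> T 0" using x min_coord_facet_nonneg[of x] tC by (force simp: T_def)
      with r show ?thesis by blast
    qed
    then show "\<exists>j. j \<in> {..<r} \<and> x \<in> T j \<and> f x = wedge_inclusion j (F j x)"
      using f_T by auto
  qed simp
  have F_nb: "F i x \<noteq> base_point" if "i < r" "0 < min_coord (t i) x" for i x
    using simplex_to_sphere_ratio(1)[of "e i" m x 0] that by (auto simp: F_def e_img base_point_def)
  have fibres: "x = y \<or> x \<in> ?A \<and> y \<in> ?A" if "x \<in> ?P" "y \<in> ?P" "f x = f y" for x y
  proof -
    have None_iff: "f z = None \<longleftrightarrow> z \<in> ?A" if "z \<in> ?P" for z
    proof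
      assume "f z = None"
      then show "z \<in> ?A" using pos_or_lower[OF that] f_pos[OF that] F_nb 
        by (auto simp: wedge_inclusion_def split: if_splits)
    qed (rule f_lower)
    show ?thesis
    proof (cases "f x = None")
      case True
      then show ?thesis using None_iff that by metis
    next
      case False
      then have "x \<notin> ?A" "y \<notin> ?A" using None_iff that by metis+
      then obtain i j where i: "i < r" "0 < min_coord (t i) x" and j: "j < r" "0 < min_coord (t j) y"
        using pos_or_lower[OF \<open>x \<in> ?P\<close>] pos_or_lower[OF \<open>y \<in> ?P\<close>] by blast
      then have "wedge_inclusion i (F i x) = wedge_inclusion j (F j y)"
        using f_pos that by metis
      then have ij: "j = i" "F i x = F i y"
        using F_nb i j by (auto simp: wedge_inclusion_def split: if_splits)
      have eq: "x (e i k) = y (e i k)" if "k \<le> m" for k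
        using that i j ij sum1 \<open>x \<in> ?P\<close> \<open>y \<in> ?P\<close> unfolding F_def
        by (intro simplex_to_sphere_inj) (auto simp: e_img)
      have "x v = y v" for v
      proof (cases "v \<in> t i")
        case True
        then obtain k where "k \<le> m" "v = e i k" using e_img[OF i(1)] by auto
        then show ?thesis using eq by simp
      next
        case False
        moreover have "{v. x v \<noteq> 0} = t i" "{v. y v \<noteq> 0} = t i"
          using min_coord_facet_pos_iff[OF that(1) tC[OF i(1)]] min_coord_facet_pos_iff[OF that(2) tC[OF i(1)]]
            i j ij by auto
        ultimately show ?thesis by (metis (mono_tags) mem_Collect_eq)
      qed
      then show ?thesis by blast
    qed
  qed
  obtain G p where G: "continuous_map (prod_topology (top_of_set {0..1::real}) (geometric_realization K))
        (geometric_realization K) G"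
    "\<And>x. x \<in> realization_points K \<Longrightarrow> G (0, x) = x"
    "\<And>s x. \<lbrakk>0 \<le> s; s \<le> 1; x \<in> realization_points (K - C)\<rbrakk> \<Longrightarrow> G (s, x) \<in> realization_points (K - C)"
    "\<And>x. x \<in> realization_points (K - C) \<Longrightarrow> G (1, x) = p"
    by (rule lower_contraction_extends[OF assms(2)]) (rule that)
  have surj: "topspace ?W \<subseteq> f ` ?P"
  proof
    fix w assume "w \<in> topspace ?W"
    then obtain i z where i: "i < r" and z: "z \<in> topspace (nsphere m)" and w: "w = wedge_inclusion i z"
      by (auto simp: topspace_wedge_of_spheres)
    have preimage: "\<exists>x\<in>?P. 0 < min_coord (t i) x \<and> F i x = z" if nb: "z \<noteq> base_point"
    proof -
      obtain x where x: "\<And>v. 0 \<le> x v" "\<And>v. v \<notin> t i \<Longrightarrow> x v = 0" "(\<Sum>j\<le>m. x (e i j)) = 1"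
          "min_coord (t i) x > 0" "simplex_to_sphere m (e i) x = z"
        using simplex_to_sphere_surj[OF e_inj[OF i] z nb] unfolding e_img[OF i] by blast
      have "{v. x v \<noteq> 0} \<in> K" 
      proof (rule finite_complex_face[OF K, of "t i"])
        show "t i \<in> K" using tC[OF i] CK by blast
        show "{v. x v \<noteq> 0} \<subseteq> t i" using x(2) by auto
      qed
      then have "x \<in> ?P"
        using x e_sum[OF i, of x] facet_finite[OF tC[OF i]] by (intro realization_pointsI[of "t i"]) auto
      then show ?thesis using x by (auto simp: F_def)
    qed
    show "w \<in> f ` ?P"
    proof (cases "z = base_point")
      case False
      then obtain x where "x \<in> ?P" "0 < min_coord (t i) x" "F i x = z" using preimage by blast
      then show ?thesis using f_pos[OF _ i] w by (intro image_eqI[of _ _ x]) auto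
    next
      case True
      obtain x where "x \<in> ?A" using assms(3) by blast
      then show ?thesis using f_lower[of x] subset_points w True inc0 by (intro image_eqI[of _ _ x]) auto
    qed
  qed
  show ?thesis
    unfolding r_def[symmetric]
  proof (rule contractible_quotient_homotopy_equivalent[of _ _ f ?A G])
    show "compact_space (geometric_realization K)"
      using compact_realization_points[OF K] by (simp add: geometric_realization_eq compact_space_subtopology)
    show "f ` topspace (geometric_realization K) = topspace ?W"
      using surj continuous_map_image_subset_topspace[OF f_cont] by (auto simp: geometric_realization_eq)
  qed (use f_cont G fibres f_lower in \<open>auto simp: geometric_realization_eq Hausdorff_space_wedge_of_spheres\<close>)
qed

end

section \<open>Matchings whose critical faces have equal size\<close>

text \<open>An acyclic matching whose critical faces \<open>C\<close> all have size \<open>Suc m\<close>. The matching sorts the other faces by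
  dimension. Pairs with a bottom of size at least \<open>Suc m\<close> can be collapsed away; what remains is the complex \<open>L\<close>
  of the pairs with tops of size at most \<open>Suc m\<close>, together with \<open>C\<close>. As \<open>L\<close> avoids the critical faces,
  it collapses to the vertex matched with the empty face, so \<open>C\<close> is attached to a contractible complex.\<close>

lemma equidimensional_matching_wedge:
  fixes rank :: "'v set \<Rightarrow> nat"
  assumes K: "finite_complex K" and empty: "{} \<in> K"
    and C: "C \<subseteq> K" "C \<noteq> {}" "\<And>S. S \<in> C \<Longrightarrow> card S = Suc m"
    and toggle: "\<And>S. S \<in> K - C \<Longrightarrow> insert (v S) S \<in> K - C \<and> S - {v S} \<in> K - C \<and>
                   v (insert (v S) S) = v S \<and> v (S - {v S}) = v S"
    and acyclic: "\<And>S x. \<lbrakk>S \<in> K - C; v S \<notin> S; x \<in> S; insert (v S) S - {x} \<in> K - C\<rbrakk> \<Longrightarrow>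
                   v (insert (v S) S - {x}) \<in> insert (v S) S - {x} \<or>
                   rank (insert (v S) S - {x}) < rank S"
  shows "geometric_realization K homotopy_equivalent_space wedge_of_spheres (card C) m"
proof -
  define L where "L = {S \<in> K - C. card S \<le> m \<or> card S = Suc m \<and> v S \<in> S}"
  define K' where "K' = L \<union> C"
  have finS: "finite S" if "S \<in> K" for S using finite_complex_finite_face[OF K that] .
  have LK: "L \<subseteq> K" "K' \<subseteq> K" "K' - C = L" using C(1) by (auto simp: L_def K'_def)
  have small: "S \<in> L" if "S \<in> K" "card S \<le> m" for S
    using that C(3) by (fastforce simp: L_def)
  have down: "T \<in> L \<or> T = S" if S: "S \<in> K'" and T: "T \<subseteq> S" for S T
  proof (cases "T = S")
    case False
    have "S \<in> K" using S LK by blast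
    then have "card T < card S" using False T finS by (meson psubsetI psubset_card_mono)
    moreover have "card S \<le> Suc m" using S C(3) by (auto simp: K'_def L_def)
    ultimately show ?thesis
      using small finite_complex_face[OF K \<open>S \<in> K\<close> T] by simp
  qed simp
  have fcL: "finite_complex L"
    using down by (intro finite_complex_subset[OF K LK(1)]) (auto simp: K'_def)
  have fcK': "finite_complex K'"
    using down by (intro finite_complex_subset[OF K LK(2)]) (auto simp: K'_def)
  have emptyL: "{} \<in> L" using small[OF empty] by simp
  have "geometric_realization K homotopy_equivalent_space geometric_realization K'"
  proof (rule acyclic_matching_collapse[of K K' v rank])
    have KK': "S \<in> K - K' \<longleftrightarrow> S \<in> K - C \<and> (Suc m < card S \<or> card S = Suc m \<and> v S \<notin> S)" for S
      by (auto simp: K'_def L_def)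
    show "insert (v S) S \<in> K - K' \<and> S - {v S} \<in> K - K' \<and>
        v (insert (v S) S) = v S \<and> v (S - {v S}) = v S" if "S \<in> K - K'" for S
    proof -
      have S: "S \<in> K - C" "Suc m < card S \<or> card S = Suc m \<and> v S \<notin> S" using that KK' by blast+
      note t = toggle[OF S(1)]
      have "finite S" using S(1) finS by blast
      show ?thesis
      proof (cases "v S \<in> S")
        case True
        define T where "T = S - {v S}"
        have T: "T \<in> K - C" "v T = v S" "v T \<notin> T" "Suc (card T) = card S"
          using t True card_Suc_Diff1[OF \<open>finite S\<close> True] by (simp_all add: T_def)
        moreover have "Suc m < card S" using S(2) True by blast
        ultimately have "T \<in> K - K'" unfolding KK' by linarith
        moreover have "insert (v S) S = S" using True by blast
        ultimately show ?thesis using that T(2) by (simp add: T_def)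
      next
        case False
        have "card (insert (v S) S) = Suc (card S)" using False \<open>finite S\<close> by simp
        then have "insert (v S) S \<in> K - K'" unfolding KK' using t S(2) by auto
        moreover have "S - {v S} = S" using False by blast
        ultimately show ?thesis using that t by simp
      qed
    qed
    show "v (insert (v S) S - {x}) \<in> insert (v S) S - {x} \<or> rank (insert (v S) S - {x}) < rank S"
      if "S \<in> K - K'" "v S \<notin> S" "x \<in> S" "insert (v S) S - {x} \<in> K - K'" for S x
      using that KK' by (intro acyclic) blast+
  qed (use K fcK' LK emptyL in \<open>auto simp: K'_def\<close>)
  also have "geometric_realization K' homotopy_equivalent_space wedge_of_spheres (card C) m"
  proof -
    interpret attached_facets K' C m
      by unfold_locales (use fcK' fcL LK C in \<open>auto simp: K'_def\<close>)
    define w where "w = v {}"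
    have tw: "{w} \<in> K - C" "v {w} = w"
      using toggle[of "{}"] emptyL by (auto simp: w_def L_def)
    then have wL: "{w} \<in> L" by (auto simp: L_def)
    let ?P = "{{}, {w}}"
    have "geometric_realization L homotopy_equivalent_space geometric_realization ?P"
    proof (rule acyclic_matching_collapse[of L ?P v rank])
      show "insert (v S) S \<in> L - ?P \<and> S - {v S} \<in> L - ?P \<and>
          v (insert (v S) S) = v S \<and> v (S - {v S}) = v S" if S: "S \<in> L - ?P" for S
      proof -
        have SC: "S \<in> K - C" using S by (auto simp: L_def)
        note t = toggle[OF SC]
        have "S \<in> L" using S by blast
        have "finite S" using SC finS by blast
        have "card (S - {v S}) \<le> m" if "v S \<in> S"
          using card_Suc_Diff1[OF \<open>finite S\<close> that] \<open>S \<in> L\<close> by (auto simp: L_def)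
        moreover have "S - {v S} = S" if "v S \<notin> S" using that by blast
        ultimately have "S - {v S} \<in> L" using small t \<open>S \<in> L\<close> by (metis DiffD1)
        moreover have "insert (v S) S \<in> L"
        proof (cases "v S \<in> S")
          case True
          then show ?thesis using \<open>S \<in> L\<close> by (simp add: insert_absorb)
        next
          case False
          then have "card (insert (v S) S) = Suc (card S)" using \<open>finite S\<close> by simp
          moreover have "card S \<le> m" using False \<open>S \<in> L\<close> by (simp add: L_def)
          ultimately show ?thesis using t by (auto simp: L_def)
        qed
        moreover have "R \<notin> ?P" if R: "R \<in> {insert (v S) S, S - {v S}}" for R
        proof
          assume "R \<in> ?P"
          then have "v R = w" using tw by (auto simp: w_def)
          moreover have "v R = v S" using R t by auto
          ultimately have "v S = w" by simp
          with \<open>R \<in> ?P\<close> R have "S \<subseteq> {w}" by auto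
          then show False using S by auto
        qed
        ultimately show ?thesis using t by blast
      qed
      show "v (insert (v S) S - {x}) \<in> insert (v S) S - {x} \<or> rank (insert (v S) S - {x}) < rank S"
        if "S \<in> L - ?P" "v S \<notin> S" "x \<in> S" "insert (v S) S - {x} \<in> L - ?P" for S x
        using that by (intro acyclic) (auto simp: L_def)
    qed (use fcL emptyL wL in \<open>auto simp: finite_complex_def\<close>)
    moreover have point: "realization_points ?P = {\<lambda>u. if u = w then 1 else 0}"
    proof (intro equalityI subsetI)
      fix x assume x: "x \<in> realization_points ?P"
      then have "{u. x u \<noteq> 0} \<subseteq> {w}" using realization_points_support[OF x] by auto
      moreover from this have "sum x {w} = 1" using realization_points_sum[OF x, of "{w}"] by simp
      ultimately show "x \<in> {\<lambda>u. if u = w then 1 else 0}" by (auto simp: fun_eq_iff)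
    qed (auto intro!: realization_pointsI[of "{w}"] split: if_splits)
    ultimately have "contractible_space (geometric_realization L)"
      by (metis contractible_space_subtopology_singleton geometric_realization_eq
          homotopy_equivalent_space_contractibility)
    moreover have "realization_points L \<noteq> {}"
      using realization_points_mono[of ?P L] point emptyL wL by auto
    ultimately show ?thesis
      using homotopy_equivalent_wedge C(2) LK(3) by simp
  qed
  finally show ?thesis .
qed

section \<open>Cyclic arcs\<close>

definition cyclic_arc :: "nat \<Rightarrow> nat \<Rightarrow> nat \<Rightarrow> nat set" where
  "cyclic_arc n k i = (\<lambda>j. (i + j) mod n) ` {..<k}"

definition arc_free :: "nat \<Rightarrow> nat \<Rightarrow> nat set set" where
  "arc_free n k = {S. S \<subseteq> {..<n} \<and> (\<forall>i<n. \<not> cyclic_arc n k i \<subseteq> S)}"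

lemma inj_on_cyclic_shift: "inj_on (\<lambda>j. (i + j) mod n) {..<n}" for i n :: nat
proof -
  have "a = b" if "a \<le> b" "b < n" and eq: "(i + a) mod n = (i + b) mod n" for a b
  proof -
    have "n dvd (i + b) - (i + a)"
      using that by (subst mod_eq_dvd_iff_nat[symmetric]) simp_all
    then have "n dvd b - a" by simp
    then show ?thesis using that by (metis dvd_imp_le diff_is_0_eq le_antisym less_imp_diff_less not_less zero_less_iff_neq_zero)
  qed
  then show ?thesis
    by (intro inj_onI) (metis lessThan_iff nat_le_linear)
qed

text \<open>A walk along the cycle that always steps forward traverses an arc.\<close>

lemma steps_arc:
  fixes h :: "nat \<Rightarrow> nat"
  assumes h0: "h 0 < n" and step: "\<And>j. Suc j < k \<Longrightarrow> h (Suc j) = Suc (h j) mod n"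
  shows "h ` {..<k} = cyclic_arc n k (h 0)"
proof -
  have *: "h j = (h 0 + j) mod n" if "j < k" for j
    using that
  proof (induction j)
    case (Suc j)
    then show ?case by (simp add: step mod_Suc_eq)
  qed (simp add: h0)
  show ?thesis
    unfolding cyclic_arc_def by (intro image_cong refl *) simp
qed

text \<open>A path in a cycle cannot turn around, because its edges are distinct: the edge used in a step is either
  always the one leaving the current vertex or always the one entering it. Hence the copies of \<open>P_k\<close> in \<open>C_n\<close> are
  exactly the arcs of \<open>k\<close> vertices, read in one of two directions. Stating the dichotomy
  through edges also covers the double edge for \<open>n = 2\<close>.\<close>

lemma devoid_complex_cycle_path:
  assumes k: "2 \<le> k" and kn: "k \<le> n"
  shows "devoid_complex (cycle_graph n) (path_graph k) = arc_free n k"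
proof -
  have "graph_free (path_graph k) (induced_subgraph (cycle_graph n) S) \<longleftrightarrow> (\<forall>i<n. \<not> cyclic_arc n k i \<subseteq> S)"
    if S: "S \<subseteq> {..<n}" for S
  proof -
    have "\<exists>H. subgraph H (induced_subgraph (cycle_graph n) S) \<and> graph_isomorphic (path_graph k) H"
      if i: "i < n" "cyclic_arc n k i \<subseteq> S" for i
    proof -
      let ?f = "\<lambda>j. (i + j) mod n"
      define H where "H = \<lparr>verts = cyclic_arc n k i, edges = ?f ` {j. Suc j < k},
          ends = (\<lambda>i. {i, Suc i mod n})\<rparr>"
      have ends: "{?f j, Suc (?f j) mod n} = ?f ` {j, Suc j}" for j
        by (simp add: mod_Suc_eq)
      have sub: "?f ` {j, Suc j} \<subseteq> cyclic_arc n k i" if "Suc j < k" for j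
        using that unfolding cyclic_arc_def by (intro image_mono) auto
      have H_sub: "subgraph H (induced_subgraph (cycle_graph n) S)"
        using i S sub by (auto simp: H_def subgraph_def induced_subgraph_def cycle_graph_def mod_Suc_eq)
      have inj: "inj_on ?f A" if "A \<subseteq> {..<k}" for A
        by (rule inj_on_subset[OF inj_on_cyclic_shift]) (use that kn in auto)
      have Suc_sub: "{j. Suc j < k} \<subseteq> {..<k}" by auto
      have "graph_isomorphic (path_graph k) H"
        unfolding graph_isomorphic_def
        using inj[of "{..<k}"] inj[OF Suc_sub] ends
        by (intro exI[of _ ?f]) (auto simp: H_def path_graph_def bij_betw_def cyclic_arc_def)
      with H_sub show ?thesis by blast
    qed
    moreover have "\<exists>i<n. cyclic_arc n k i \<subseteq> S"
      if H: "subgraph H (induced_subgraph (cycle_graph n) S)" "graph_isomorphic (path_graph k) H" for H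
    proof -
      obtain f g where f: "bij_betw f {..<k} (verts H)" and g: "bij_betw g {i. Suc i < k} (edges H)"
        and fg: "\<And>e. Suc e < k \<Longrightarrow> ends H (g e) = {f e, f (Suc e)}"
        using H(2) by (auto simp: graph_isomorphic_def path_graph_def)
      have vS: "verts H \<subseteq> S" and vn: "verts H \<subseteq> {..<n}"
        using H(1) by (auto simp: subgraph_def induced_subgraph_def cycle_graph_def)
      have edge: "{g e, Suc (g e) mod n} = {f e, f (Suc e)}" "g e < n" if "Suc e < k" for e
      proof -
        have "g e \<in> edges H" using g that by (auto simp: bij_betw_def)
        then show "{g e, Suc (g e) mod n} = {f e, f (Suc e)}" "g e < n"
          using H(1) fg[OF that] by (auto simp: subgraph_def induced_subgraph_def cycle_graph_def)
      qed
      have f_img: "f ` {..<k} = verts H" using f by (simp add: bij_betw_def)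
      have f_ne: "f e \<noteq> f (Suc e)" if "Suc e < k" for e
        using f that inj_onD[of f "{..<k}" e "Suc e"] by (auto simp: bij_betw_def)
      have g_ne: "g e \<noteq> g (Suc e)" if "Suc (Suc e) < k" for e
        using g that inj_onD[of g "{i. Suc i < k}" e "Suc e"] by (auto simp: bij_betw_def)
      have f_lt: "f e < n" if "e < k" for e
        using f_img vn that by auto
      have fwd: "f (Suc e) = Suc (g e) mod n" if "Suc e < k" "g e = f e" for e
        using edge(1)[OF that(1)] that(2) f_ne[OF that(1)] by (auto simp: doubleton_eq_iff)
      have bwd: "f e = Suc (g e) mod n" if "Suc e < k" "g e = f (Suc e)" for e
        using edge(1)[OF that(1)] that(2) f_ne[OF that(1)] by (auto simp: doubleton_eq_iff)
      have either: "g e = f e \<or> g e = f (Suc e)" if "Suc e < k" for e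
        using edge(1)[OF that] by (auto simp: doubleton_eq_iff)
      have inj_Suc: "a = b" if "a < n" "b < n" "Suc a mod n = Suc b mod n" for a b
        using inj_onD[OF inj_on_cyclic_shift[of 1 n], of a b] that by simp
      show ?thesis
      proof (cases "g 0 = f 0")
        case True
        have same: "g e = f e" if "Suc e < k" for e
          using that
        proof (induction e)
          case (Suc e)
          then have e: "Suc e < k" "g e = f e" by simp_all
          show ?case
          proof (rule ccontr)
            assume "g (Suc e) \<noteq> f (Suc e)"
            then have "g (Suc e) = f (Suc (Suc e))" using either[OF Suc.prems] by simp
            then have "f (Suc e) = Suc (g (Suc e)) mod n" by (rule bwd[OF Suc.prems])
            then have "g e = g (Suc e)"
              using fwd[OF e] inj_Suc[OF edge(2)[OF e(1)] edge(2)[OF Suc.prems]] by simp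
            then show False using g_ne[OF Suc.prems] by simp
          qed
        qed (use True in simp)
        have "f ` {..<k} = cyclic_arc n k (f 0)"
          using f_lt[of 0] k fwd same by (intro steps_arc) auto
        then show ?thesis using f_img vS f_lt[of 0] k by auto
      next
        case False
        have same: "g e = f (Suc e)" if "Suc e < k" for e
          using that
        proof (induction e)
          case 0
          then show ?case using False either by blast
        next
          case (Suc e)
          then have e: "Suc e < k" "g e = f (Suc e)" by simp_all
          then have "g (Suc e) \<noteq> f (Suc e)" using g_ne[OF Suc.prems] by simp
          then show ?case using either[OF Suc.prems] by simp
        qed
        let ?h = "\<lambda>j. f (k - 1 - j)"
        have "?h ` {..<k} = cyclic_arc n k (?h 0)"
        proof (rule steps_arc)
          fix j assume j: "Suc j < k"
          then have "Suc (k - 1 - Suc j) = k - 1 - j" by simp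
          then show "?h (Suc j) = Suc (?h j) mod n"
            using bwd[of "k - 1 - Suc j"] same[of "k - 1 - Suc j"] j by simp
        qed (use f_lt k in simp)
        moreover have "?h ` {..<k} \<subseteq> f ` {..<k}" using k by auto
        moreover have "?h 0 < n" using f_lt k by simp
        ultimately show ?thesis using f_img vS by blast
      qed
    qed
    ultimately show ?thesis unfolding graph_free_def by blast
  qed
  then show ?thesis
    by (auto simp: devoid_complex_def arc_free_def cycle_graph_def)
qed

section \<open>The matching on the arc-free sets\<close>

definition run :: "nat set \<Rightarrow> nat" where
  "run S = (LEAST b. Suc b \<notin> S)"

locale cyclic_arcs =
  fixes n k :: nat
  assumes two_le_k: "2 \<le> k" and k_le_n: "k \<le> n"
begin

abbreviation K :: "nat set set" where "K \<equiv> arc_free n k"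

text \<open>If \<open>S\<close> starts with the run \<open>{1..b}\<close>, then vertex \<open>0\<close> cannot be added to \<open>S\<close> precisely if the \<open>k - 1 - b\<close>
  vertices before \<open>0\<close>, which start at \<open>tail b\<close>, all belong to \<open>S\<close>; together with \<open>0\<close> and the run they would
  form an arc of length \<open>k\<close>. In this case the vertices after the gap \<open>b + 1\<close> are read in blocks of length \<open>k + 1\<close>,
  the \<open>j\<close>-th of which begins at \<open>start b j\<close>.\<close>

definition tail :: "nat \<Rightarrow> nat" where
  "tail b = n - (k - 1 - b)"

definition start :: "nat \<Rightarrow> nat \<Rightarrow> nat" where
  "start b j = b + 2 + j * (k + 1)"

definition zero_blocked :: "nat set \<Rightarrow> bool" where
  "zero_blocked S \<longleftrightarrow> {tail (run S)..<n} \<subseteq> S"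

text \<open>When the vertex before \<open>s\<close> is missing, this is the obstruction to adding \<open>s\<close>. A set that is blocked
  at the start of a block misses both the first and the last vertex of the block, so the situation repeats
  at the next block.\<close>

definition blocked :: "nat set \<Rightarrow> nat \<Rightarrow> bool" where
  "blocked S s \<longleftrightarrow> {s<..<s + k} \<subseteq> S"

definition free_index :: "nat set \<Rightarrow> nat" where
  "free_index S = (LEAST j. \<not> blocked S (start (run S) j))"

definition free_start :: "nat set \<Rightarrow> nat" where
  "free_start S = start (run S) (free_index S)"

text \<open>Toggle the first admissible vertex: \<open>0\<close> if possible, otherwise the start of the first block that is not
  blocked. A set is critical if this start is not a vertex before the tail: the vertices of the tail cannot be
  toggled without unblocking \<open>0\<close>.\<close>

definition toggle :: "nat set \<Rightarrow> nat" where
  "toggle S = (if zero_blocked S then free_start S else 0)"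

definition critical :: "nat set set" where
  "critical = {S \<in> K. zero_blocked S \<and> tail (run S) \<le> free_start S}"

text \<open>A lexicographic comparison of \<open>run S\<close> and \<open>free_start S\<close>, encoded as a number; \<open>free_start S < n\<close> for
  noncritical sets in the second case.\<close>

definition level :: "nat set \<Rightarrow> nat" where
  "level S = (if zero_blocked S then Suc (run S * n + free_start S) else 0)"

lemma arc_free_bounded: "S \<in> K \<Longrightarrow> S \<subseteq> {..<n}"
  by (simp add: arc_free_def)

lemma arc_free_down: "S \<in> K \<Longrightarrow> T \<subseteq> S \<Longrightarrow> T \<in> K"
proof -
  assume S: "S \<in> K" and T: "T \<subseteq> S"
  have "T \<subseteq> {..<n}" using order_trans[OF T arc_free_bounded[OF S]] .
  moreover have "\<not> cyclic_arc n k i \<subseteq> T" if "i < n" for i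
    using S that order_trans[OF _ T, of "cyclic_arc n k i"] by (auto simp: arc_free_def)
  ultimately show "T \<in> K" by (simp add: arc_free_def)
qed

lemma not_arc_freeI: "i < n \<Longrightarrow> cyclic_arc n k i \<subseteq> S \<Longrightarrow> S \<notin> K"
  unfolding arc_free_def by blast

lemma finite_complex_arc_free: "finite_complex K"
proof -
  have "\<Union>K \<subseteq> {..<n}" using arc_free_bounded by blast
  then have "finite (\<Union>K)" by (rule finite_subset) simp
  then show ?thesis
    using arc_free_down by (auto simp: finite_complex_def)
qed

lemma arc_eq_interval:
  assumes "i + k \<le> n"
  shows "cyclic_arc n k i = {i..<i + k}"
proof -
  have "cyclic_arc n k i = (\<lambda>j. i + j) ` {..<k}"
    unfolding cyclic_arc_def using assms by (intro image_cong) auto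
  then show ?thesis by (simp add: lessThan_atLeast0 add.commute)
qed

lemma wrapping_arc:
  assumes "i < n" "n < i + k"
  shows "cyclic_arc n k i = {i..<n} \<union> {..<i + k - n}"
proof -
  have "cyclic_arc n k i = (\<lambda>j. (i + j) mod n) ` ({..<n - i} \<union> {n - i..<k})"
    unfolding cyclic_arc_def using assms by (intro arg_cong2[where f = image] refl) auto
  also have "\<dots> = (\<lambda>j. i + j) ` {..<n - i} \<union> (\<lambda>j. i + j - n) ` {n - i..<k}"
  proof -
    have "(i + j) mod n = i + j - n" if "j \<in> {n - i..<k}" for j
    proof -
      have "n \<le> i + j" "i + j - n < n" using that assms k_le_n by auto
      then show ?thesis by (simp add: le_mod_geq)
    qed
    then show ?thesis by (auto simp: image_Un intro!: image_cong)
  qed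
  also have "(\<lambda>j. i + j) ` {..<n - i} = {i..<n}"
    using assms by (simp add: lessThan_atLeast0 add.commute)
  also have "(\<lambda>j. i + j - n) ` {n - i..<k} = {..<i + k - n}"
  proof (intro equalityI subsetI)
    fix x assume "x \<in> {..<i + k - n}"
    then show "x \<in> (\<lambda>j. i + j - n) ` {n - i..<k}"
      using assms by (intro image_eqI[of _ _ "x + n - i"]) auto
  qed (use assms in auto)
  finally show ?thesis .
qed

text \<open>Without vertex \<open>0\<close> the cycle becomes a path, and arcs become ordinary intervals.\<close>

lemma arc_free_avoiding_zero:
  assumes "S \<subseteq> {..<n}" "0 \<notin> S"
  shows "S \<in> K \<longleftrightarrow> (\<forall>i. \<not> {i..<i + k} \<subseteq> S)"
proof
  assume S: "S \<in> K"
  show "\<forall>i. \<not> {i..<i + k} \<subseteq> S"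
  proof (intro allI notI)
    fix i assume i: "{i..<i + k} \<subseteq> S"
    then have "i + k - 1 \<in> S" using two_le_k by auto
    then have "i + k \<le> n" using assms(1) by auto
    then have "cyclic_arc n k i \<subseteq> S" "i < n" using i two_le_k arc_eq_interval by auto
    then show False using S by (auto simp: arc_free_def)
  qed
next
  assume no: "\<forall>i. \<not> {i..<i + k} \<subseteq> S"
  have "\<not> cyclic_arc n k i \<subseteq> S" if "i < n" for i
  proof (cases "i + k \<le> n")
    case True
    then show ?thesis using no by (simp add: arc_eq_interval)
  next
    case False
    then have "0 \<in> cyclic_arc n k i" using that by (simp add: wrapping_arc)
    then show ?thesis using assms(2) by blast
  qed
  then show "S \<in> K" using assms(1) by (simp add: arc_free_def)
qed

lemma Suc_run_notin: "S \<subseteq> {..<n} \<Longrightarrow> Suc (run S) \<notin> S"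
  unfolding run_def by (rule LeastI[of _ n]) auto

lemma run_in: "1 \<le> i \<Longrightarrow> i \<le> run S \<Longrightarrow> i \<in> S"
  unfolding run_def using not_less_Least[of "i - 1" "\<lambda>b. Suc b \<notin> S"] by fastforce

lemma run_eqI: "\<lbrakk>Suc b \<notin> S; \<And>i. 1 \<le> i \<Longrightarrow> i \<le> b \<Longrightarrow> i \<in> S\<rbrakk> \<Longrightarrow> run S = b"
  unfolding run_def
proof (rule Least_equality)
  fix y assume "\<And>i. 1 \<le> i \<Longrightarrow> i \<le> b \<Longrightarrow> i \<in> S" "Suc y \<notin> S"
  from this(1)[of "Suc y"] this(2) show "b \<le> y" by fastforce
qed

lemma run_le: "Suc b \<notin> S \<Longrightarrow> run S \<le> b"
  unfolding run_def by (rule Least_le)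

lemma run_less_k:
  assumes S: "S \<in> K"
  shows "run S < k"
proof (rule ccontr)
  assume "\<not> run S < k"
  then have *: "{1..<1 + k} \<subseteq> S" using run_in[of _ S] by auto
  then have "k \<in> S" using two_le_k by auto
  then have "1 + k \<le> n" using arc_free_bounded[OF S] by auto
  then have "cyclic_arc n k 1 \<subseteq> S" "1 < n" using * two_le_k by (simp_all add: arc_eq_interval)
  then show False using S by (auto simp: arc_free_def)
qed

lemma tail_bounds: "b < k \<Longrightarrow> 1 \<le> tail b" "tail b \<le> n"
  using k_le_n two_le_k by (auto simp: tail_def)

lemma zero_blocked_iff:
  assumes S: "S \<in> K"
  shows "zero_blocked S \<longleftrightarrow> insert 0 S \<notin> K"
proof
  assume Z: "zero_blocked S"
  let ?b = "run S"
  have b: "?b < k" by (rule run_less_k[OF S])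
  have low: "{..?b} \<subseteq> insert 0 S" using run_in[of _ S] by (auto simp: Suc_le_eq)
  show "insert 0 S \<notin> K"
  proof (cases "?b = k - 1")
    case True
    have "{0..<0 + k} = {..?b}" using True two_le_k by auto
    then have "cyclic_arc n k 0 = {..?b}" using arc_eq_interval[of 0] k_le_n by simp
    then show ?thesis using low two_le_k k_le_n by (intro not_arc_freeI[of 0]) simp_all
  next
    case False
    have t: "tail ?b < n" "n < tail ?b + k" "tail ?b + k - n = Suc ?b" 
      using False b k_le_n by (auto simp: tail_def)
    have "cyclic_arc n k (tail ?b) = {tail ?b..<n} \<union> {..?b}"
      using wrapping_arc[OF t(1,2)] t(3) by (simp add: lessThan_Suc_atMost)
    also have "\<dots> \<subseteq> insert 0 S" using low Z unfolding zero_blocked_def by blast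
    finally show ?thesis using t(1) by (intro not_arc_freeI)
  qed
next
  assume "insert 0 S \<notin> K"
  moreover have "insert 0 S \<subseteq> {..<n}" using arc_free_bounded[OF S] two_le_k k_le_n by auto
  ultimately obtain i where i: "i < n" "cyclic_arc n k i \<subseteq> insert 0 S" by (auto simp: arc_free_def)
  have "\<not> cyclic_arc n k i \<subseteq> S" using S i(1) by (auto simp: arc_free_def)
  then have z: "0 \<in> cyclic_arc n k i" "0 \<notin> S" using i(2) by auto
  have wrap: "k - 1 - run S \<le> n - i" if "0 < i" "n < i + k"
  proof (rule ccontr)
    assume "\<not> ?thesis"
    then have "Suc (run S) < i + k - n" using that i(1) by linarith
    then have "Suc (run S) \<in> insert 0 S" using i(2) by (auto simp: wrapping_arc that i(1))
    then show False using Suc_run_notin[OF arc_free_bounded[OF S]] by simp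
  qed
  have at_0: "k - 1 - run S = 0" if "i = 0"
  proof (rule ccontr)
    assume "\<not> ?thesis"
    then have "Suc (run S) \<in> cyclic_arc n k 0" using k_le_n by (simp add: arc_eq_interval)
    then show False using i(2) that Suc_run_notin[OF arc_free_bounded[OF S]] by auto
  qed
  have i_cases: "i = 0 \<or> n < i + k"
    using z(1) arc_eq_interval[of i] by (cases "i + k \<le> n") auto
  have *: "i = 0 \<and> tail (run S) = n \<or> 0 < i \<and> n < i + k \<and> i \<le> tail (run S)"
  proof (cases "i = 0")
    case True
    then show ?thesis using at_0 by (simp add: tail_def)
  next
    case False
    then have "0 < i" "n < i + k" using i_cases by auto
    with wrap i(1) show ?thesis unfolding tail_def by linarith
  qed
  show "zero_blocked S"
  proof (cases "i = 0 \<and> tail (run S) = n")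
    case False
    with * have **: "0 < i" "n < i + k" "i \<le> tail (run S)" by auto
    then have "{i..<n} \<subseteq> insert 0 S" using i by (auto simp: wrapping_arc)
    then have "{i..<n} \<subseteq> S" using subset_insert[of 0 "{i..<n}" S] **(1) by simp
    moreover have "{tail (run S)..<n} \<subseteq> {i..<n}" using **(3) by simp
    ultimately show ?thesis unfolding zero_blocked_def by blast
  qed (simp add: zero_blocked_def)
qed

lemma zero_blocked_zero_notin: "S \<in> K \<Longrightarrow> zero_blocked S \<Longrightarrow> 0 \<notin> S"
  using zero_blocked_iff by (metis insert_absorb)

lemma start_mono: "i \<le> j \<Longrightarrow> start b i \<le> start b j"
  unfolding start_def by (intro add_left_mono mult_le_mono1)

lemma start_Suc: "start b (Suc j) = Suc (start b j + k)"
  by (simp add: start_def)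

lemma start_gap: "i < j \<Longrightarrow> start b i + k < start b j"
  using start_mono[of "Suc i" j b] by (simp add: start_Suc)

lemma free_index_free:
  assumes "S \<subseteq> {..<n}"
  shows "\<not> blocked S (free_start S)"
  unfolding free_start_def free_index_def
proof (rule LeastI[of "\<lambda>j. \<not> blocked S (start (run S) j)" n])
  have "Suc (start (run S) n) \<notin> S" using assms by (auto simp: start_def)
  then show "\<not> blocked S (start (run S) n)"
    using two_le_k by (auto simp: blocked_def subset_iff)
qed

lemma blocked_before_free_index: "j < free_index S \<Longrightarrow> blocked S (start (run S) j)"
  unfolding free_index_def using not_less_Least by blast

lemma free_index_le: "\<not> blocked S (start (run S) j) \<Longrightarrow> free_index S \<le> j"
  unfolding free_index_def by (rule Least_le)

lemma free_index_eqI: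
  "\<lbrakk>\<And>i. i < j \<Longrightarrow> blocked S (start (run S) i); \<not> blocked S (start (run S) j)\<rbrakk> \<Longrightarrow> free_index S = j"
  unfolding free_index_def by (rule Least_equality) (auto simp: not_less[symmetric])

lemma block_ends_notin:
  assumes "S \<in> K" "zero_blocked S" "j < free_index S"
  shows "start (run S) j \<notin> S" "start (run S) j + k \<notin> S"
proof -
  let ?s = "start (run S) j"
  have no: "\<not> {i..<i + k} \<subseteq> S" for i
    using arc_free_avoiding_zero[OF arc_free_bounded zero_blocked_zero_notin] assms by blast
  have b: "{?s<..<?s + k} \<subseteq> S"
    using blocked_before_free_index[OF assms(3)] by (simp add: blocked_def)
  show "?s \<notin> S"
  proof
    assume "?s \<in> S"
    moreover have "{?s..<?s + k} \<subseteq> insert ?s {?s<..<?s + k}" by auto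
    ultimately have "{?s..<?s + k} \<subseteq> S" using b by blast
    then show False using no by blast
  qed
  show "?s + k \<notin> S"
  proof
    assume "?s + k \<in> S"
    moreover have "{Suc ?s..<Suc ?s + k} \<subseteq> insert (?s + k) {?s<..<?s + k}" by auto
    ultimately have "{Suc ?s..<Suc ?s + k} \<subseteq> S" using b by blast
    then show False using no by blast
  qed
qed

lemma before_free_start_notin:
  assumes "S \<in> K" "zero_blocked S"
  shows "free_start S - 1 \<notin> S"
proof (cases "free_index S")
  case 0
  then show ?thesis
    using Suc_run_notin[OF arc_free_bounded[OF assms(1)]] by (simp add: free_start_def start_def)
next
  case (Suc j)
  then show ?thesis
    using block_ends_notin(2)[OF assms, of j] by (simp add: free_start_def start_Suc)
qed

lemma free_start_ge: "run S + 2 \<le> free_start S"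
  by (simp add: free_start_def start_def)

text \<open>Toggling the start of the first free block changes none of the data that led to this vertex: it lies
  behind the run and the blocked blocks, and before the tail.\<close>

lemma zero_blocked_invariant:
  assumes Z: "zero_blocked S" and S: "S \<in> K" and F: "free_start S < tail (run S)"
    and T: "T = insert (free_start S) S \<or> T = S - {free_start S}"
  shows "run T = run S" "zero_blocked T" "free_index T = free_index S" "free_start T = free_start S"
proof -
  note ge = free_start_ge[of S]
  have agree: "x \<in> T \<longleftrightarrow> x \<in> S" if "x \<noteq> free_start S" for x using T that by auto
  show r: "run T = run S"
  proof (rule run_eqI)
    show "Suc (run S) \<notin> T"
      using agree[of "Suc (run S)"] ge Suc_run_notin[OF arc_free_bounded[OF S]] by auto
    show "i \<in> T" if "1 \<le> i" "i \<le> run S" for i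
      using agree[of i] ge that run_in[OF that] by auto
  qed
  show "zero_blocked T"
    using Z F agree unfolding zero_blocked_def r by (auto simp: subset_iff)
  show fi: "free_index T = free_index S"
  proof (rule free_index_eqI, unfold r)
    fix j assume j: "j < free_index S"
    then have "start (run S) j + k < free_start S" by (simp add: free_start_def start_gap)
    then show "blocked T (start (run S) j)"
      using blocked_before_free_index[OF j] agree by (auto simp: blocked_def subset_iff)
  next
    show "\<not> blocked T (start (run S) (free_index S))"
      using free_index_free[OF arc_free_bounded[OF S]] agree
      by (auto simp: blocked_def subset_iff free_start_def)
  qed
  show "free_start T = free_start S" by (simp add: free_start_def r fi)
qed

text \<open>The predecessor of the toggled vertex is missing, so a new interval of length \<open>k\<close> would have to begin at the
  toggled vertex, which is excluded because the block is not blocked.\<close>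

lemma insert_free_start_in:
  assumes S: "S \<in> K" and Z: "zero_blocked S" and F: "free_start S < tail (run S)"
  shows "insert (free_start S) S \<in> K"
proof -
  let ?s = "free_start S" and ?T = "insert (free_start S) S"
  have lt: "?s < n" using F tail_bounds(2)[of "run S"] by linarith
  have z: "0 \<notin> ?T" using zero_blocked_zero_notin[OF S Z] free_start_ge[of S] by auto
  have "\<not> {i..<i + k} \<subseteq> ?T" for i
  proof
    assume i: "{i..<i + k} \<subseteq> ?T"
    have "\<not> {i..<i + k} \<subseteq> S"
      using arc_free_avoiding_zero[OF arc_free_bounded[OF S] zero_blocked_zero_notin[OF S Z]] S by blast
    then have s: "?s \<in> {i..<i + k}" using i by blast
    have "?s - 1 \<notin> ?T" using before_free_start_notin[OF S Z] free_start_ge[of S] by auto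
    then have "?s - 1 \<notin> {i..<i + k}" using i by blast
    with s have "i = ?s" by auto
    have "{?s<..<?s + k} \<subseteq> {?s..<?s + k} - {?s}" by auto
    also have "\<dots> \<subseteq> S" using i unfolding \<open>i = ?s\<close> by blast
    finally have "blocked S ?s" by (simp add: blocked_def)
    then show False using free_index_free[OF arc_free_bounded[OF S]] by blast
  qed
  then show ?thesis
    using arc_free_avoiding_zero[of ?T] z lt arc_free_bounded[OF S] by auto
qed

lemma toggle_matching:
  assumes "S \<in> K - critical"
  shows "insert (toggle S) S \<in> K - critical \<and> S - {toggle S} \<in> K - critical \<and>
         toggle (insert (toggle S) S) = toggle S \<and> toggle (S - {toggle S}) = toggle S"
proof -
  have S: "S \<in> K" using assms by blast
  have minus: "S - {toggle S} \<in> K" using arc_free_down[OF S] by blast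
  show ?thesis
  proof (cases "zero_blocked S")
    case True
    then have F: "free_start S < tail (run S)" using assms by (auto simp: critical_def not_le)
    have t: "toggle S = free_start S" using True by (simp add: toggle_def)
    note inv = zero_blocked_invariant[OF True S F]
    show ?thesis
      using insert_free_start_in[OF S True F] minus F inv[of "insert (free_start S) S"]
        inv[of "S - {free_start S}"] unfolding t by (simp add: critical_def toggle_def)
  next
    case False
    then have t: "toggle S = 0" by (simp add: toggle_def)
    have inv: "\<not> zero_blocked T" if "T = insert 0 S \<or> T = S - {0}" for T
    proof -
      have "run T = run S"
      proof (rule run_eqI)
        show "Suc (run S) \<notin> T" using that Suc_run_notin[OF arc_free_bounded[OF S]] by auto
        show "i \<in> T" if "1 \<le> i" "i \<le> run S" for i
          using run_in[OF that] that \<open>T = insert 0 S \<or> T = S - {0}\<close> by auto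
      qed
      moreover have "0 \<notin> {tail (run S)..<n}" using tail_bounds(1)[OF run_less_k[OF S]] by auto
      ultimately show ?thesis using False that by (auto simp: zero_blocked_def)
    qed
    show ?thesis
      using zero_blocked_iff[OF S] False minus inv[of "insert 0 S"] inv[of "S - {0}"]
      unfolding t by (simp add: critical_def toggle_def)
  qed
qed

text \<open>Removing another vertex \<open>x\<close> from a top face \<open>T \<union> {x}\<close> has one of two effects. If \<open>x\<close> was examined by the
  procedure before the toggled vertex, the decisions change earlier and the level drops: \<open>0\<close> becomes
  admissible, the run shrinks, or an earlier block becomes free. Otherwise the same vertex is toggled in \<open>T\<close>,
  and \<open>T\<close> contains it, so \<open>T\<close> is no bottom face.\<close>

lemma toggle_acyclic:
  assumes SC: "S \<in> K - critical" and notin: "toggle S \<notin> S" and x: "x \<in> S"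
    and TC: "insert (toggle S) S - {x} \<in> K - critical"
  shows "toggle (insert (toggle S) S - {x}) \<in> insert (toggle S) S - {x} \<or>
         level (insert (toggle S) S - {x}) < level S"
proof -
  define T where "T = insert (toggle S) S - {x}"
  have S: "S \<in> K" and T: "T \<in> K" using SC TC by (auto simp: T_def)
  have tT: "toggle S \<in> T" using notin x by (auto simp: T_def)
  have "toggle T \<in> T \<or> level T < level S"
  proof (cases "zero_blocked S")
    case False
    then have "0 \<in> T" using tT by (simp add: toggle_def)
    then have "toggle T = 0" using zero_blocked_zero_notin[OF T] by (auto simp: toggle_def)
    then show ?thesis using \<open>0 \<in> T\<close> by simp
  next
    case Z: True
    have F: "free_start S < tail (run S)" using SC Z by (auto simp: critical_def not_le)
    have tS: "toggle S = free_start S" using Z by (simp add: toggle_def)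
    show ?thesis
    proof (cases "zero_blocked T")
      case False
      then show ?thesis using Z by (simp add: level_def)
    next
      case ZT: True
      have FT: "free_start T < tail (run T)" using TC ZT by (auto simp: critical_def not_le T_def)
      have tail: "tail (run T) \<le> n" by (rule tail_bounds)
      have "Suc (run S) \<notin> T"
        using Suc_run_notin[OF arc_free_bounded[OF S]] free_start_ge[of S] by (auto simp: T_def tS)
      then have le: "run T \<le> run S" by (rule run_le)
      show ?thesis
      proof (cases "run T < run S")
        case True
        then have "run T * n + n \<le> run S * n" using mult_le_mono1[of "Suc (run T)" "run S" n] by simp
        then show ?thesis using Z ZT FT tail by (simp add: level_def)
      next
        case False
        then have r: "run T = run S" using le by simp
        show ?thesis
        proof (cases "\<exists>j<free_index S. \<not> blocked T (start (run S) j)")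
          case True
          then obtain j where j: "j < free_index S" "\<not> blocked T (start (run S) j)" by blast
          then have "free_index T \<le> j" using free_index_le[of T j] r by simp
          then have "free_start T < free_start S"
            unfolding free_start_def r using start_gap[of "free_index T" "free_index S" "run S"] j(1) by linarith
          then show ?thesis using Z ZT r by (simp add: level_def)
        next
          case False
          have "free_index T = free_index S"
          proof (rule free_index_eqI, unfold r)
            show "blocked T (start (run S) i)" if "i < free_index S" for i
              using False that by blast
            show "\<not> blocked T (start (run S) (free_index S))"
              using free_index_free[OF arc_free_bounded[OF S]]
              by (auto simp: blocked_def subset_iff free_start_def T_def tS)
          qed
          then have "toggle T = free_start S" using ZT r by (simp add: toggle_def free_start_def)
          then show ?thesis using tT tS by simp
        qed
      qed
    qed
  qed
  then show ?thesis by (simp add: T_def)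
qed

section \<open>The critical sets\<close>

text \<open>The only candidate for a critical set with run \<open>b\<close> and \<open>J\<close> blocked blocks: each blocked block is filled except
  for its two end points, and the tail is filled because \<open>0\<close> is blocked.\<close>

definition crit :: "nat \<Rightarrow> nat \<Rightarrow> nat set" where
  "crit b J = {1..b} \<union> (\<Union>j<J. {start b j<..<start b j + k}) \<union> {tail b..<n}"

lemma start_notin_blocks:
  "start b i \<notin> (\<Union>j<J. {start b j<..<start b j + k})"
  "start b i + k \<notin> (\<Union>j<J. {start b j<..<start b j + k})"
proof -
  have "\<not> (start b j < start b i \<and> start b i < start b j + k) \<and>
        \<not> (start b j < start b i + k \<and> start b i + k < start b j + k)" for j
    using start_gap[of i j b] start_gap[of j i b] by (cases i j rule: linorder_cases) auto
  then show "start b i \<notin> (\<Union>j<J. {start b j<..<start b j + k})"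
    "start b i + k \<notin> (\<Union>j<J. {start b j<..<start b j + k})" by auto
qed

lemma block_position:
  assumes "start b 0 \<le> x" "x < start b J"
  obtains j r where "j < J" "x = start b j + r" "r \<le> k"
proof -
  let ?y = "x - (b + 2)"
  define j where "j = ?y div (k + 1)"
  define r where "r = ?y mod (k + 1)"
  have "?y = j * (k + 1) + r" unfolding j_def r_def by (rule div_mult_mod_eq[symmetric])
  then have x: "x = start b j + r" using assms(1) by (simp add: start_def)
  have "r < k + 1" by (simp add: r_def)
  moreover have "j < J"
  proof (rule ccontr)
    assume "\<not> j < J"
    then have "start b J \<le> start b j" by (simp add: start_mono)
    then show False using assms(2) x by simp
  qed
  ultimately show ?thesis using that x by simp
qed

text \<open>In a critical set the blocked blocks must end right at the tail or right at the last vertex: the last vertex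
  of a block is missing, so it lies before the tail or is vertex \<open>0\<close> again. These two possibilities are the two
  equations for \<open>n\<close>. In the first one \<open>n\<close> is a multiple of \<open>k + 1\<close> and \<open>run S\<close> is arbitrary; in the second one
  \<open>run S + 1\<close> is the remainder of \<open>n\<close>.\<close>

lemma critical_eq_crit:
  assumes "S \<in> critical"
  shows "S = crit (run S) (free_index S)"
    and "n = (free_index S + 1) * (k + 1) \<or> n = free_index S * (k + 1) + run S + 1"
proof -
  let ?b = "run S" and ?J = "free_index S"
  have S: "S \<in> K" and Z: "zero_blocked S" and F: "tail ?b \<le> start ?b ?J"
    using assms by (auto simp: critical_def free_start_def)
  have b: "?b < k" by (rule run_less_k[OF S])
  note Sn = arc_free_bounded[OF S]
  have tailS: "{tail ?b..<n} \<subseteq> S" using Z by (simp add: zero_blocked_def)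
  have Suc_b: "Suc ?b \<notin> S" by (rule Suc_run_notin[OF Sn])
  show "S = crit ?b ?J"
  proof (intro equalityI subsetI)
    fix x assume x: "x \<in> S"
    have x0: "x \<noteq> 0" using x zero_blocked_zero_notin[OF S Z] by metis
    consider "x \<le> ?b" | "x = Suc ?b" | "start ?b 0 \<le> x" "x < start ?b ?J" | "start ?b ?J \<le> x"
      by (fastforce simp: start_def)
    then show "x \<in> crit ?b ?J"
    proof cases
      case 3
      then obtain j r where j: "j < ?J" "x = start ?b j + r" "r \<le> k"
        by (rule block_position)
      then have "r \<noteq> 0" "r \<noteq> k" using x j(2) block_ends_notin[OF S Z j(1)] by (metis add_0_right, metis)
      then have "x \<in> {start ?b j<..<start ?b j + k}" using j by auto
      then show ?thesis using j(1) unfolding crit_def by blast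
    next
      case 4
      then show ?thesis using F x Sn by (auto simp: crit_def)
    qed (use x x0 Suc_b in \<open>auto simp: crit_def\<close>)
  next
    fix x assume "x \<in> crit ?b ?J"
    then consider "x \<in> {1..?b}" | j where "j < ?J" "x \<in> {start ?b j<..<start ?b j + k}" | "x \<in> {tail ?b..<n}"
      by (auto simp: crit_def)
    then show "x \<in> S"
    proof cases
      case 2
      then show ?thesis using blocked_before_free_index[of j S] unfolding blocked_def by blast
    qed (use run_in tailS in auto)
  qed
  show "n = (?J + 1) * (k + 1) \<or> n = ?J * (k + 1) + ?b + 1"
  proof (cases ?J)
    case 0
    have "tail ?b \<le> ?b + 2" using F 0 by (simp add: start_def)
    moreover have "\<not> (tail ?b \<le> Suc ?b \<and> Suc ?b < n)" using tailS Suc_b by auto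
    ultimately show ?thesis using 0 b k_le_n by (auto simp: tail_def)
  next
    case (Suc j)
    let ?s = "start ?b j"
    have j: "j < ?J" using Suc by simp
    have "?s + k - 1 \<in> S"
      using blocked_before_free_index[OF j] two_le_k by (auto simp: blocked_def)
    then have "?s + k \<le> n" using Sn two_le_k by auto
    moreover have "\<not> (tail ?b \<le> ?s + k \<and> ?s + k < n)"
      using block_ends_notin(2)[OF S Z j] tailS by auto
    ultimately have "tail ?b = Suc (?s + k) \<or> ?s + k = n"
      using F Suc by (auto simp: start_Suc)
    then show ?thesis
    proof
      assume "tail ?b = Suc (?s + k)"
      then have "n = Suc (?s + k) + (k - 1 - ?b)" using b k_le_n by (simp add: tail_def)
      then show ?thesis using Suc b by (simp add: start_def algebra_simps)
    next
      assume "?s + k = n"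
      then show ?thesis using Suc by (simp add: start_def algebra_simps)
    qed
  qed
qed

text \<open>Every interval of length \<open>k\<close> meets the complement of \<open>crit b J\<close>, since the missing vertices \<open>0\<close>, \<open>b + 1\<close> and the ends
  of the blocks leave at most \<open>k - 1\<close> consecutive vertices between them.\<close>

lemma crit_critical:
  assumes b: "b < k" and n: "n = (J + 1) * (k + 1) \<or> n = J * (k + 1) + b + 1"
  shows "crit b J \<in> critical" "run (crit b J) = b"
proof -
  let ?S = "crit b J" and ?B = "\<Union>j<J. {start b j<..<start b j + k}"
  \<comment> \<open>The positions after the last block either are the forced tail or do not exist.\<close>
  have end_cases: "tail b = start b J \<or> start b J = Suc n"
    using n b k_le_n by (auto simp: tail_def start_def algebra_simps)
  \<comment> \<open>The last vertex of a block lies before the tail, or the block ends at vertex \<open>0\<close>.\<close>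
  have pre: "start b j + k < tail b \<or> start b j + k = n" if "j < J" for j
  proof -
    have *: "start b j + k < start b J" using that by (rule start_gap)
    from end_cases show ?thesis
    proof
      assume "start b J = Suc n"
      show ?thesis
      proof (cases "Suc j = J")
        case True
        then show ?thesis using \<open>start b J = Suc n\<close> start_Suc[of b j] by simp
      next
        case False
        then have "start b (Suc j) + k < start b J" using that by (intro start_gap) simp
        then have "start b j + k + k + 1 < Suc n" using \<open>start b J = Suc n\<close> by (simp add: start_Suc)
        then show ?thesis using b k_le_n by (simp add: tail_def)
      qed
    qed (use * in simp)
  qed
  have Suc_b: "Suc b \<notin> ?S"
  proof -
    have "\<not> (tail b \<le> Suc b \<and> Suc b < n)"
    proof (cases J)
      case 0
      then show ?thesis using end_cases by (auto simp: start_def)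
    next
      case (Suc j)
      then show ?thesis using pre[of 0] b two_le_k by (auto simp: start_def tail_def)
    qed
    then show ?thesis by (auto simp: crit_def start_def)
  qed
  show run: "run ?S = b"
    by (rule run_eqI[OF Suc_b]) (simp add: crit_def)
  have ends: "start b j \<notin> ?S" "start b j + k \<notin> ?S" if "j < J" for j
  proof -
    have "start b j \<notin> {1..b}" "start b j + k \<notin> {1..b}" by (auto simp: start_def)
    moreover have "start b j + k \<notin> {tail b..<n}" using pre[OF that] by auto
    moreover have "start b j \<notin> {tail b..<n}"
      using pre[OF that] b k_le_n by (auto simp: tail_def)
    ultimately show "start b j \<notin> ?S" "start b j + k \<notin> ?S"
      using start_notin_blocks[of b j J] unfolding crit_def by blast+
  qed
  have z: "0 \<notin> ?S" using tail_bounds(1)[OF b] by (auto simp: crit_def)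
  have sub: "?S \<subseteq> {..<n}"
  proof -
    have "start b j + k \<le> n" if "j < J" for j using pre[OF that] tail_bounds(2)[of b] by linarith
    then have "?B \<subseteq> {..<n}" by fastforce
    then show ?thesis using b k_le_n by (auto simp: crit_def)
  qed
  have "\<not> {i..<i + k} \<subseteq> ?S" for i
  proof
    assume i: "{i..<i + k} \<subseteq> ?S"
    have mem: "x \<in> ?S" if "i \<le> x" "x < i + k" for x using i that by auto
    have "i \<noteq> 0" using mem[of 0] z two_le_k by auto
    then have "\<not> i \<le> Suc b" using mem[of "Suc b"] Suc_b b by auto
    then have i2: "start b 0 \<le> i" by (simp add: start_def)
    show False
    proof (cases "i < start b J")
      case True
      then obtain j r where j: "j < J" "i = start b j + r" "r \<le> k"
        using block_position[OF i2] by blast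
      show False
      proof (cases "r = 0")
        case True
        then show False using mem[of i] two_le_k ends(1)[OF j(1)] j(2) by simp
      next
        case False
        then show False using mem[of "start b j + k"] ends(2)[OF j(1)] j by simp
      qed
    next
      case False
      have "i + k - 1 \<in> ?S" using mem two_le_k by auto
      then have "i + k \<le> n" using sub two_le_k by auto
      then show False using end_cases False b two_le_k by (auto simp: tail_def)
    qed
  qed
  then have SK: "?S \<in> K" using arc_free_avoiding_zero[OF sub z] by blast
  have Z: "zero_blocked ?S" unfolding zero_blocked_def run by (auto simp: crit_def)
  have "J \<le> free_index ?S"
  proof (rule ccontr)
    define j where "j = free_index ?S"
    assume "\<not> J \<le> free_index ?S"
    then have "j < J" by (simp add: j_def)
    then have "blocked ?S (start b j)" unfolding blocked_def crit_def by blast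
    moreover have "free_start ?S = start b j" by (simp add: free_start_def run j_def)
    ultimately show False using free_index_free[OF sub] by simp
  qed
  then have "start b J \<le> free_start ?S" by (simp add: free_start_def run start_mono)
  moreover have "tail b \<le> start b J" using end_cases tail_bounds(2)[of b] by auto
  ultimately show "?S \<in> critical" using SK Z by (simp add: critical_def run)
qed

lemma card_blocks: "card (\<Union>j<J. {start b j<..<start b j + k}) = J * (k - 1)"
proof (induction J)
  case (Suc J)
  let ?B = "\<Union>j<J. {start b j<..<start b j + k}" and ?I = "{start b J<..<start b J + k}"
  have "?B \<inter> ?I = {}"
  proof -
    have "start b j + k < start b J" if "j < J" for j using that by (rule start_gap)
    then show ?thesis by fastforce
  qed
  moreover have "(\<Union>j<Suc J. {start b j<..<start b j + k}) = ?B \<union> ?I"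
    by (auto simp: less_Suc_eq)
  ultimately show ?case using Suc two_le_k by (simp add: card_Un_disjoint)
qed simp

text \<open>For \<open>n = (J + 1) * (k + 1)\<close> the run and the tail together contribute \<open>k - 1\<close> vertices; in the other case
  the tail is part of the last block.\<close>

lemma card_crit:
  assumes b: "b < k" and n: "n = (J + 1) * (k + 1) \<or> n = J * (k + 1) + b + 1"
  shows "card (crit b J) = J * (k - 1) + (if n = (J + 1) * (k + 1) then k - 1 else b)"
proof -
  let ?B = "\<Union>j<J. {start b j<..<start b j + k}"
  have B_lt: "x < start b J" if "x \<in> ?B" for x
  proof -
    from that obtain j where j: "j < J" "x < start b j + k" by auto
    then show ?thesis using start_gap[OF j(1), of b] by linarith
  qed
  have AB: "{1..b} \<inter> ?B = {}" by (auto simp: start_def)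
  have cAB: "card ({1..b} \<union> ?B) = b + J * (k - 1)"
    using AB by (simp add: card_Un_disjoint card_blocks)
  show ?thesis
  proof (cases "n = (J + 1) * (k + 1)")
    case True
    then have "n = J * (k + 1) + (k + 1)" by simp
    then have t: "tail b = start b J" unfolding tail_def start_def using b by linarith
    then have "({1..b} \<union> ?B) \<inter> {tail b..<n} = {}"
      using B_lt by (fastforce simp: start_def)
    then have "card (crit b J) = b + J * (k - 1) + (n - tail b)"
      unfolding crit_def using cAB by (subst card_Un_disjoint) auto
    moreover have "n - tail b = k - 1 - b" using b k_le_n by (simp add: tail_def)
    ultimately have "card (crit b J) = J * (k - 1) + (k - 1)" using b by simp
    then show ?thesis unfolding if_P[OF True] .
  next
    case False
    have "{tail b..<n} \<subseteq> ?B"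
    proof (cases J)
      case 0
      then have "k - 1 - b = 0" using False n b k_le_n by simp
      then show ?thesis unfolding tail_def by simp
    next
      case (Suc j)
      then have "start b j + k = n" using False n by (simp add: start_def algebra_simps)
      then have "{tail b..<n} \<subseteq> {start b j<..<start b j + k}" using b k_le_n by (auto simp: tail_def)
      then show ?thesis using Suc by auto
    qed
    then have "crit b J = {1..b} \<union> ?B" by (auto simp: crit_def)
    then show ?thesis using cAB False by simp
  qed
qed

end

lemma quotient_remainder_unique:
  fixes q r m :: nat
  assumes "r < m"
  shows "(q * m + r) mod m = r" "(q * m + r) div m = q"
  using assms by simp_all

context cyclic_arcs
begin

lemma empty_in: "{} \<in> K"
proof -
  have "cyclic_arc n k i \<noteq> {}" for i
    using two_le_k by (auto simp: cyclic_arc_def lessThan_empty_iff)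
  then show ?thesis by (simp add: arc_free_def)
qed

text \<open>Different runs give different critical sets, so the spheres are counted by the runs.\<close>

lemma wedge_from_critical_sets:
  assumes "critical = (\<lambda>b. crit b J) ` B" "B \<noteq> {}"
    and B: "\<And>b. b \<in> B \<Longrightarrow> b < k \<and> (n = (J + 1) * (k + 1) \<or> n = J * (k + 1) + b + 1)"
    and card: "\<And>b. b \<in> B \<Longrightarrow> card (crit b J) = Suc m"
  shows "geometric_realization K homotopy_equivalent_space wedge_of_spheres (card B) m"
proof -
  have "inj_on (\<lambda>b. crit b J) B"
    using B crit_critical(2) by (intro inj_on_inverseI[of _ run]) blast
  then have "card critical = card B" by (simp add: assms(1) card_image)
  moreover have "geometric_realization K homotopy_equivalent_space wedge_of_spheres (card critical) m"
  proof (rule equidimensional_matching_wedge[OF finite_complex_arc_free empty_in])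
    show "critical \<subseteq> K" by (auto simp: critical_def)
    show "critical \<noteq> {}" using assms(1,2) by simp
    show "card S = Suc m" if "S \<in> critical" for S using that assms(1) card by auto
  qed (fact toggle_matching, fact toggle_acyclic)
  ultimately show ?thesis by simp
qed

text \<open>Here the run is arbitrary, which gives \<open>k\<close> critical sets.\<close>

lemma multiple_wedge:
  assumes "n = (k + 1) * t"
  shows "geometric_realization K homotopy_equivalent_space wedge_of_spheres k (t * (k - 1) - 1)"
proof -
  have t: "0 < t" using assms two_le_k k_le_n by (cases t) auto
  then have n: "n = (t - 1 + 1) * (k + 1)" using assms by (simp add: mult.commute)
  have crit_eq: "critical = (\<lambda>b. crit b (t - 1)) ` {..<k}"
  proof (intro equalityI subsetI)
    fix S assume S: "S \<in> critical"
    then have b: "run S < k" using run_less_k by (simp add: critical_def)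
    have "\<not> n = free_index S * (k + 1) + run S + 1"
    proof
      assume "n = free_index S * (k + 1) + run S + 1"
      then have "n = free_index S * (k + 1) + (run S + 1)" by simp
      moreover have "run S + 1 < k + 1" using b by simp
      ultimately have "n mod (k + 1) = run S + 1" by (metis quotient_remainder_unique(1))
      moreover have "n mod (k + 1) = 0" using assms by (metis mod_mult_self1_is_0)
      ultimately show False by simp
    qed
    then have "(free_index S + 1) * (k + 1) = (t - 1 + 1) * (k + 1)"
      using critical_eq_crit(2)[OF S] n by metis
    then have "free_index S + 1 = t - 1 + 1" by (subst (asm) mult_right_cancel) simp_all
    then have "free_index S = t - 1" by simp
    then show "S \<in> (\<lambda>b. crit b (t - 1)) ` {..<k}"
      using critical_eq_crit(1)[OF S] b by auto
  qed (use crit_critical(1) n in auto)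
  have crit_card: "card (crit b (t - 1)) = Suc (t * (k - 1) - 1)" if "b < k" for b
  proof -
    have "card (crit b (t - 1)) = (t - 1) * (k - 1) + (k - 1)"
      using card_crit[OF that, of "t - 1"] n by simp
    also have "\<dots> = t * (k - 1)" using t by (cases t) simp_all
    also have "\<dots> = Suc (t * (k - 1) - 1)" using t two_le_k by simp
    finally show ?thesis .
  qed
  have "geometric_realization K homotopy_equivalent_space wedge_of_spheres (card {..<k}) (t * (k - 1) - 1)"
  proof (rule wedge_from_critical_sets[OF crit_eq])
    show "{..<k} \<noteq> {}" using two_le_k by (simp add: lessThan_empty_iff)
    show "b < k \<and> (n = (t - 1 + 1) * (k + 1) \<or> n = (t - 1) * (k + 1) + b + 1)" if "b \<in> {..<k}" for b
      using that by (intro conjI disjI1[OF n]) simp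
    show "card (crit b (t - 1)) = Suc (t * (k - 1) - 1)" if "b \<in> {..<k}" for b
      by (rule crit_card) (use that in simp)
  qed
  then show ?thesis by simp
qed

text \<open>Here the remainder \<open>d\<close> forces the run to be \<open>d - 1\<close>, which leaves one critical set.\<close>

lemma nonmultiple_sphere:
  assumes "n = (k + 1) * t + d" "1 \<le> d" "d \<le> k"
  shows "geometric_realization K homotopy_equivalent_space nsphere (t * (k - 1) + d - 2)"
proof -
  have n: "n = t * (k + 1) + (d - 1) + 1" using assms by (simp add: mult.commute)
  have dk: "d - 1 < k" using assms(2,3) by linarith
  have "n = t * (k + 1) + d" using assms(1) by (simp only: mult.commute)
  then have nd: "n mod (k + 1) = d" "n div (k + 1) = t"
    using quotient_remainder_unique[of d "k + 1" t] assms(3) by simp_all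
  have crit_eq: "critical = (\<lambda>b. crit b t) ` {d - 1}"
  proof (intro equalityI subsetI)
    fix S assume S: "S \<in> critical"
    then have b: "run S < k" using run_less_k by (simp add: critical_def)
    have "\<not> n = (free_index S + 1) * (k + 1)"
      using nd(1) assms(2) by (metis mod_mult_self2_is_0 not_one_le_zero)
    then have n': "n = free_index S * (k + 1) + (run S + 1)" using critical_eq_crit(2)[OF S] by simp
    then have "n mod (k + 1) = run S + 1" "n div (k + 1) = free_index S"
      using quotient_remainder_unique[of "run S + 1" "k + 1" "free_index S"] b by simp_all
    then have "run S = d - 1" "free_index S = t" using nd by simp_all
    then show "S \<in> (\<lambda>b. crit b t) ` {d - 1}" using critical_eq_crit(1)[OF S] by simp
  qed (use crit_critical(1)[OF dk disjI2[OF n]] in simp)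
  have crit_card: "card (crit (d - 1) t) = Suc (t * (k - 1) + d - 2)"
  proof -
    have ne: "n \<noteq> (t + 1) * (k + 1)" using assms by simp
    have "card (crit (d - 1) t) = t * (k - 1) + (d - 1)"
      using card_crit[OF dk disjI2[OF n]] unfolding if_not_P[OF ne] .
    moreover have "2 \<le> t * (k - 1) + d"
    proof (cases t)
      case 0
      then show ?thesis using assms(1) two_le_k k_le_n by simp
    qed (use two_le_k assms(2) in simp)
    ultimately show ?thesis using assms(2) by simp
  qed
  have "geometric_realization K homotopy_equivalent_space wedge_of_spheres (card {d - 1}) (t * (k - 1) + d - 2)"
  proof (rule wedge_from_critical_sets[OF crit_eq])
    show "b < k \<and> (n = (t + 1) * (k + 1) \<or> n = t * (k + 1) + b + 1)" if "b \<in> {d - 1}" for b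
      using that dk n by blast
    show "card (crit b t) = Suc (t * (k - 1) + d - 2)" if "b \<in> {d - 1}" for b
      using that crit_card by blast
  qed simp
  also have "wedge_of_spheres (card {d - 1}) (t * (k - 1) + d - 2)
      homotopy_equivalent_space nsphere (t * (k - 1) + d - 2)"
    using wedge_of_one_sphere by (simp add: homeomorphic_imp_homotopy_equivalent_space)
  finally show ?thesis .
qed

end

theorem theorem5p2:
  fixes n k t :: nat
  assumes "2 \<le> k" and "k \<le> n"
  defines "D \<equiv> geometric_realization (devoid_complex (cycle_graph n) (path_graph k))"
  shows "(n = (k + 1) * t \<longrightarrow>
            D homotopy_equivalent_space wedge_of_spheres k (t * (k - 1) - 1)) \<and>
         (n = (k + 1) * t + 1 \<longrightarrow>
            D homotopy_equivalent_space nsphere (t * (k - 1) - 1)) \<and>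
         (\<forall>d. 2 \<le> d \<and> d \<le> k - 1 \<and> n = (k + 1) * t + d \<longrightarrow>
            D homotopy_equivalent_space nsphere (t * (k - 1) + d - 2)) \<and>
         (n = (k + 1) * t + k \<longrightarrow>
            D homotopy_equivalent_space nsphere (t * (k - 1) + k - 2))"
proof -
  interpret cyclic_arcs n k using assms by unfold_locales
  have D: "D = geometric_realization K"
    using devoid_complex_cycle_path[OF assms(1,2)] by (simp add: D_def)
  have "t * (k - 1) + 1 - 2 = t * (k - 1) - 1" by simp
  then show ?thesis
    unfolding D using multiple_wedge[of t] nonmultiple_sphere[of t] assms(1) by auto
qed

end
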